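(* Consider problem $\min_{\mathbf x\in\mathbb R^n}F(\mathbf x)=\sum_{i=1}^I f_i(\mathbf x)$ where each $f_i$ is $L_i$-Lipschitz differentiable and $F$ is $\tau$-strongly convex, and let $\mathbf x^\star$ be its unique minimizer. Let $\{(\mathbf x_i^k)_{i=1}^I\}_k$ be generated by ASY-SONATA (as described in the context) with constant step-size $\gamma^k\equiv\gamma$. Then there exists a constant $\bar\gamma_1>0$ such that for every $\gamma\in(0,\bar\gamma_1)$ there is $\lambda\in(0,1)$ with $\|\mathbf x^k-\mathbf 1_I\otimes\mathbf x^\star\|=\mathcal O(\lambda^k)$, where $\mathbf x^k=[\mathbf x_1^{k\top},\dots,\mathbf x_I^{k\top}]^\top$. Moreover, there is a constant $\hat\gamma_1\in(0,\bar\gamma_1)$ such that for $\gamma\in(0,\hat\gamma_1]$ one may take $\lambda=1-\tau\eta^2\gamma/2$ with $\eta=\bar m^{K_1}$, $K_1=(2I-1)T+ID$.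
   Context: Graph: $\mathcal G=(\mathcal V,\mathcal E)$, $\mathcal V=\{1,\dots,I\}$, strongly connected digraph without self-loops; $\mathcal N_i^{\rm in}=\{j:(j,i)\in\mathcal E\}$, $\mathcal N_i^{\rm out}=\{j:(i,j)\in\mathcal E\}$. Weight matrices $W=(w_{ij})$ (row-stochastic) and $A=(a_{ij})$ (column-stochastic) satisfy, for some $\bar m\in(0,1)$: diagonal entries $\ge\bar m$, entries $(i,j)$ with $(j,i)\in\mathcal E$ are $\ge\bar m$, all other entries $0$. Asynchrony model: $(i^k,\mathbf d^k)_{k\in\mathbb N_0}$, $i^k\in\mathcal V$, $\mathbf d^k=(d_j^k)_{j\in\mathcal N^{\rm in}_{i^k}}$, with every agent appearing among $i^k,\dots,i^{k+T-1}$ for all $k$ and $0\le d_j^k\le D$. ASY-SONATA: initialization $\mathbf x_i^0\in\mathbb R^n$, $\mathbf z_i^0=\nabla f_i(\mathbf x_i^0)$, $\tilde{\boldsymbol\rho}_{ij}^0=0$, $\tau_{ij}^{-1}=-D$, and $\boldsymbol\rho_{ij}^t=0$, $\mathbf v_i^t=0$ for $t=-D,\dots,0$. At iteration $k$ with $i=i^k$: (1) $\tau_{ij}^k=\max(\tau_{ij}^{k-1},k-d_j^k)$, $j\in\mathcal N_i^{\rm in}$; (2) $\mathbf v_i^{k+1}=\mathbf x_i^k-\gamma^k\mathbf z_i^k$; (3) $\mathbf x_i^{k+1}=w_{ii}\mathbf v_i^{k+1}+\sum_{j\in\mathcal N_i^{\rm in}}w_{ij}\mathbf v_j^{\tau_{ij}^k}$;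 (4) $\mathbf z_i^{k+1/2}=\mathbf z_i^k+\sum_{j\in\mathcal N_i^{\rm in}}(\boldsymbol\rho_{ij}^{\tau_{ij}^k}-\tilde{\boldsymbol\rho}_{ij}^k)+\nabla f_i(\mathbf x_i^{k+1})-\nabla f_i(\mathbf x_i^k)$; (5) $\mathbf z_i^{k+1}=a_{ii}\mathbf z_i^{k+1/2}$ and $\boldsymbol\rho_{ji}^{k+1}=\boldsymbol\rho_{ji}^k+a_{ji}\mathbf z_i^{k+1/2}$ for $j\in\mathcal N_i^{\rm out}$; (6) $\tilde{\boldsymbol\rho}_{ij}^{k+1}=\boldsymbol\rho_{ij}^{\tau_{ij}^k}$ for $j\in\mathcal N_i^{\rm in}$; (7) all other variables keep their values. *)

theory Defs
  imports "HOL-Analysis.Analysis" "HOL-Library.Landau_Symbols"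
begin

definition strongly_convex :: "real \<Rightarrow> ('v::real_normed_vector \<Rightarrow> real) \<Rightarrow> bool" where
  "strongly_convex tc F \<longleftrightarrow>
     (\<forall>x y t. 0 \<le> t \<and> t \<le> 1 \<longrightarrow>
        F (t *\<^sub>R x + (1 - t) *\<^sub>R y)
          \<le> t * F x + (1 - t) * F y - tc / 2 * t * (1 - t) * (norm (x - y))\<^sup>2)"

definition weight_pattern :: "('i \<times> 'i) set \<Rightarrow> real \<Rightarrow> ('i \<Rightarrow> 'i \<Rightarrow> real) \<Rightarrow> bool" where
  "weight_pattern E mbar M \<longleftrightarrow>
     (\<forall>i. M i i \<ge> mbar) \<and>
     (\<forall>i j. (j, i) \<in> E \<longrightarrow> M i j \<ge> mbar) \<and>
     (\<forall>i j. i \<noteq> j \<and> (j, i) \<notin> E \<longrightarrow> M i j = 0)"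

text \<open>Trajectories of ASY-SONATA.  Agents are the elements of the finite type 'i.
  Agent activation sequence ik, delays d k j (meaningful for j an in-neighbour of ik k),
  step sizes gam k, gradients g i.  Time indices of v and rho are integers so that the
  initial values at times -D..0 can be stored; tau k i j is tau_ij^k.\<close>
definition asy_sonata ::
  "('i::finite \<times> 'i) set \<Rightarrow> ('i \<Rightarrow> 'i \<Rightarrow> real) \<Rightarrow> ('i \<Rightarrow> 'i \<Rightarrow> real)
   \<Rightarrow> ('i \<Rightarrow> 'v::real_vector \<Rightarrow> 'v) \<Rightarrow> (nat \<Rightarrow> real) \<Rightarrow> (nat \<Rightarrow> 'i) \<Rightarrow> (nat \<Rightarrow> 'i \<Rightarrow> nat)
   \<Rightarrow> nat \<Rightarrow> ('i \<Rightarrow> 'v)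
   \<Rightarrow> (nat \<Rightarrow> 'i \<Rightarrow> 'v) \<Rightarrow> (nat \<Rightarrow> 'i \<Rightarrow> 'v) \<Rightarrow> (int \<Rightarrow> 'i \<Rightarrow> 'v)
   \<Rightarrow> (int \<Rightarrow> 'i \<Rightarrow> 'i \<Rightarrow> 'v) \<Rightarrow> (nat \<Rightarrow> 'i \<Rightarrow> 'i \<Rightarrow> 'v) \<Rightarrow> (nat \<Rightarrow> 'i \<Rightarrow> 'i \<Rightarrow> int) \<Rightarrow> bool"
  where
  "asy_sonata E W A g gam ik d D x0 x z v rho rt tau \<longleftrightarrow>
     \<comment> \<open>initialization\<close>
     (\<forall>i. x 0 i = x0 i) \<and>
     (\<forall>i. z 0 i = g i (x 0 i)) \<and>
     (\<forall>i j. rt 0 i j = 0) \<and>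
     (\<forall>t i. - int D \<le> t \<and> t \<le> 0 \<longrightarrow> v t i = 0) \<and>
     (\<forall>t i j. - int D \<le> t \<and> t \<le> 0 \<longrightarrow> rho t i j = 0) \<and>
     \<comment> \<open>step (1), with tau_ij^{-1} = -D; other agents keep their values\<close>
     (\<forall>k i j. tau k i j =
        (let p = (if k = 0 then - int D else tau (k - 1) i j) in
         if i = ik k \<and> (j, i) \<in> E then max p (int k - int (d k j)) else p)) \<and>
     (\<forall>k i.
        let zh = z k i + (\<Sum>j | (j, i) \<in> E. rho (tau k i j) i j - rt k i j)
                 + g i (x (Suc k) i) - g i (x k i) in
        \<comment> \<open>step (2)\<close>
        v (int (Suc k)) i = (if i = ik k then x k i - gam k *\<^sub>R z k i else v (int k) i) \<and>
        \<comment> \<open>step (3)\<close>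
        x (Suc k) i = (if i = ik k
                       then W i i *\<^sub>R v (int (Suc k)) i
                            + (\<Sum>j | (j, i) \<in> E. W i j *\<^sub>R v (tau k i j) j)
                       else x k i) \<and>
        \<comment> \<open>steps (4)-(5)\<close>
        z (Suc k) i = (if i = ik k then A i i *\<^sub>R zh else z k i) \<and>
        (\<forall>j. rho (int (Suc k)) j i =
              (if i = ik k \<and> (i, j) \<in> E then rho (int k) j i + A j i *\<^sub>R zh
               else rho (int k) j i)) \<and>
        \<comment> \<open>step (6)\<close>
        (\<forall>j. rt (Suc k) i j =
              (if i = ik k \<and> (j, i) \<in> E then rho (tau k i j) i j else rt k i j)))"

end

theory Submission
  imports Defs
begin

text \<open>
  Delays are removed by augmentation: stale copies of the v_i become extra nodes of a row-stochastic
  chain, and mass in transit on an edge becomes extra nodes of a column-stochastic chain. Tracing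
  paths of K1 steps shows that, over K1 steps, every agent receives from and sends to every node
  with weight at least \<eta> = mbar^K1. Hence disagreement among the copies of x and the gradient-tracking
  error both contract by 1 - \<eta> over K1 steps, up to perturbations controlled by the step size. A
  convex combination of the augmented x-nodes follows an inexact gradient step on F with step size
  between \<eta>^2 \<gamma> and \<gamma>, whose factor 1 - tc \<eta>^2 \<gamma> + O(\<gamma>^2) absorbs the remaining errors, because these
  are O(\<gamma>) relative to the distance to the minimizer.
\<close>

subsection \<open>Products of stochastic matrices\<close>

text \<open>Activations and delays are arbitrary, so the augmented matrices vary with time and no
  fixed Perron vector is available to average against. Two reference objects replace it. For
  tracking, \<open>xi\<close> transports a unit mass with the same matrices; since the total tracked
  mass always equals the sum \<open>G\<close> of the local gradients, \<open>y - xi G\<close> has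
  zero sum, which is what makes it shrink in l1 norm. For consensus, \<open>forecast\<close> looks
  ahead to a finite horizon N, so no limit has to be constructed. The price is that the optimality
  error depends on N: all constants must be uniform in N, and the bound at time n is read off with a
  horizon beyond n + K1. The square in \<open>\<eta>\<^sup>2\<close> arises because a step of the
  active agent is scaled twice: by its weight in the forecast and by its share of the tracked
  gradient, each at least \<open>\<eta>\<close>. The second bound is available only from time K1 on,
  so the start of the run is absorbed into the constant of the geometric bound.\<close>

text \<open>Later factors multiply on the left: \<open>mprod S M k n s t\<close> is the weight that
  the value at \<open>t\<close> at time \<open>k\<close> has in the value at \<open>s\<close> at
  time \<open>k + n\<close>.\<close>

primrec mprod :: "'s set \<Rightarrow> (nat \<Rightarrow> 's \<Rightarrow> 's \<Rightarrow> real) \<Rightarrow> nat \<Rightarrow> nat \<Rightarrow> 's \<Rightarrow> 's \<Rightarrow> real" where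
  "mprod S M k 0 = (\<lambda>s t. if s = t then 1 else 0)"
| "mprod S M k (Suc n) = (\<lambda>s t. \<Sum>u\<in>S. M (k + n) s u * mprod S M k n u t)"

section \<open>Weighted paths in products of nonnegative matrices\<close>

locale nonneg_chain =
  fixes S :: "'s set" and M :: "nat \<Rightarrow> 's \<Rightarrow> 's \<Rightarrow> real" and mb :: real
  assumes finS: "finite S"
    and M_nonneg: "\<And>k s t. s \<in> S \<Longrightarrow> t \<in> S \<Longrightarrow> 0 \<le> M k s t"
    and mb_pos: "0 < mb" and mb_le1: "mb \<le> 1"
begin

abbreviation P where "P \<equiv> mprod S M"

lemma P_nonneg: "s \<in> S \<Longrightarrow> t \<in> S \<Longrightarrow> 0 \<le> P k n s t"
  by (induction n arbitrary: s) (auto intro!: sum_nonneg mult_nonneg_nonneg M_nonneg)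

lemma P_add:
  assumes "s \<in> S"
  shows "P k (m + n) s t = (\<Sum>u\<in>S. P (k + m) n s u * P k m u t)"
  using assms
proof (induction n arbitrary: s)
  case 0
  have "(\<Sum>u\<in>S. P (k + m) 0 s u * P k m u t) = (\<Sum>u\<in>S. if s = u then P k m u t else 0)"
    by (intro sum.cong) auto
  also have "\<dots> = P k m s t" using finS 0 by (subst sum.delta') auto
  finally show ?case by simp
next
  case (Suc n)
  have "P k (m + Suc n) s t = (\<Sum>v\<in>S. M (k + m + n) s v * (\<Sum>u\<in>S. P (k + m) n v u * P k m u t))"
    using Suc by (simp add: add.assoc)
  also have "\<dots> = (\<Sum>v\<in>S. \<Sum>u\<in>S. M (k + m + n) s v * P (k + m) n v u * P k m u t)"
    by (simp add: sum_distrib_left mult.assoc)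
  also have "\<dots> = (\<Sum>u\<in>S. \<Sum>v\<in>S. M (k + m + n) s v * P (k + m) n v u * P k m u t)"
    by (rule sum.swap)
  also have "\<dots> = (\<Sum>u\<in>S. P (k + m) (Suc n) s u * P k m u t)"
    by (simp add: sum_distrib_right)
  finally show ?case .
qed

lemma P_1: "t \<in> S \<Longrightarrow> P k (Suc 0) s t = M k s t"
  using finS by (simp add: if_distrib sum.delta cong: if_cong)

text \<open>Arguments follow the direction of travel, from \<open>t\<close> to \<open>s\<close>,
  opposite to the matrix indices. Every step, also an idle one of weight 1, is charged the factor
  \<open>mb\<close>, so only the number of steps matters.\<close>

definition reach :: "nat \<Rightarrow> nat \<Rightarrow> 's \<Rightarrow> 's \<Rightarrow> bool" where
  "reach k n t s \<longleftrightarrow> s \<in> S \<and> t \<in> S \<and> mb ^ n \<le> P k n s t"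

lemma reach_refl: "s \<in> S \<Longrightarrow> reach k 0 s s"
  by (simp add: reach_def)

lemma reach_step:
  assumes "reach k n t u" "s \<in> S" "mb \<le> M (k + n) s u"
  shows "reach k (Suc n) t s"
proof -
  have "mb * mb ^ n \<le> M (k + n) s u * P k n u t"
    using assms mb_pos by (intro mult_mono) (auto simp: reach_def)
  also have "\<dots> \<le> (\<Sum>u\<in>S. M (k + n) s u * P k n u t)"
    using assms finS
    by (intro member_le_sum) (auto simp: reach_def intro!: mult_nonneg_nonneg M_nonneg P_nonneg)
  finally show ?thesis using assms by (simp add: reach_def)
qed

lemma reach_trans:
  assumes "reach k m t u" "reach (k + m) n u s"
  shows "reach k (m + n) t s"
proof -
  have s: "s \<in> S" "t \<in> S" "u \<in> S" using assms by (auto simp: reach_def)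
  have "mb ^ n * mb ^ m \<le> P (k + m) n s u * P k m u t"
    using assms mb_pos s P_nonneg by (intro mult_mono) (auto simp: reach_def)
  also have "\<dots> \<le> (\<Sum>u\<in>S. P (k + m) n s u * P k m u t)"
    using s finS by (intro member_le_sum) (auto intro!: mult_nonneg_nonneg P_nonneg)
  finally show ?thesis using s by (simp add: reach_def P_add power_add mult.commute)
qed

lemma reach_persist:
  assumes "reach k n t s" "n \<le> n'" "\<And>l. mb \<le> M l s s"
  shows "reach k n' t s"
  using assms(2)
proof (induction rule: dec_induct)
  case (step l)
  then show ?case using reach_step[OF step.IH _ assms(3)] by (simp add: reach_def)
qed (rule assms(1))

end

section \<open>Row-stochastic products: averaging and contraction of differences\<close>

locale row_chain = nonneg_chain S M mb for S :: "'s set" and M mb +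
  assumes row_sum: "\<And>k s. s \<in> S \<Longrightarrow> (\<Sum>t\<in>S. M k s t) = 1"
begin

lemma P_row_sum: "s \<in> S \<Longrightarrow> (\<Sum>t\<in>S. P k n s t) = 1"
proof (induction n arbitrary: s)
  case 0
  then show ?case using finS by simp
next
  case (Suc n)
  have "(\<Sum>t\<in>S. P k (Suc n) s t) = (\<Sum>u\<in>S. \<Sum>t\<in>S. M (k + n) s u * P k n u t)"
    by (simp, rule sum.swap)
  also have "\<dots> = (\<Sum>u\<in>S. M (k + n) s u)"
    using Suc by (simp add: sum_distrib_left[symmetric])
  finally show ?case using Suc row_sum by simp
qed

lemma P_le_1: "s \<in> S \<Longrightarrow> t \<in> S \<Longrightarrow> P k n s t \<le> 1"
  using P_row_sum[of s k n] member_le_sum[of t S "P k n s"] P_nonneg finS by auto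

text \<open>Further averaging by row-stochastic factors on the left cannot lower the minimum of a
  column.\<close>

lemma P_column_lower_bound:
  assumes "\<And>u. u \<in> S \<Longrightarrow> \<eta> \<le> P k K u j" "K \<le> n" "s \<in> S" "j \<in> S"
  shows "\<eta> \<le> P k n s j"
proof -
  have "\<eta> = (\<Sum>u\<in>S. P (k + K) (n - K) s u * \<eta>)"
    using P_row_sum[OF assms(3)] by (simp add: sum_distrib_right[symmetric])
  also have "\<dots> \<le> (\<Sum>u\<in>S. P (k + K) (n - K) s u * P k K u j)"
    using assms by (intro sum_mono mult_left_mono P_nonneg) auto
  also have "\<dots> = P k (K + (n - K)) s j" by (rule P_add[OF assms(3), symmetric])
  finally show ?thesis using assms by simp
qed

end

lemma norm_convex_combination_diff_le:
  fixes h :: "'s \<Rightarrow> 'v::real_normed_vector"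
  assumes "finite S" "\<And>t. t \<in> S \<Longrightarrow> 0 \<le> p t" "(\<Sum>t\<in>S. p t) = 1"
    and "\<And>t. t \<in> S \<Longrightarrow> norm (h t - w) \<le> B"
  shows "norm ((\<Sum>t\<in>S. p t *\<^sub>R h t) - w) \<le> B"
proof -
  have "(\<Sum>t\<in>S. p t *\<^sub>R h t) - w = (\<Sum>t\<in>S. p t *\<^sub>R (h t - w))"
    using assms(3) by (simp add: scaleR_diff_right sum_subtractf scaleR_sum_left[symmetric])
  also have "norm \<dots> \<le> (\<Sum>t\<in>S. p t * B)"
    using assms by (intro sum_norm_le) (auto intro!: mult_left_mono)
  finally show ?thesis using assms(3) by (simp add: sum_distrib_right[symmetric])
qed

text \<open>Divided by their common mass \<open>c\<close>, both sums are convex combinations of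
  points at mutual distance at most \<open>B\<close>. This is applied to what remains of two rows
  after a common part is removed.\<close>

lemma norm_substochastic_difference_le:
  fixes h :: "'s \<Rightarrow> 'v::real_normed_vector"
  assumes S: "finite S" and p: "\<And>t. t \<in> S \<Longrightarrow> 0 \<le> p t" "(\<Sum>t\<in>S. p t) = c"
    and q: "\<And>t. t \<in> S \<Longrightarrow> 0 \<le> q t" "(\<Sum>t\<in>S. q t) = c"
    and B: "\<And>s t. s \<in> S \<Longrightarrow> t \<in> S \<Longrightarrow> norm (h s - h t) \<le> B"
  shows "norm ((\<Sum>t\<in>S. p t *\<^sub>R h t) - (\<Sum>t\<in>S. q t *\<^sub>R h t)) \<le> c * B"
proof -
  have c0: "0 \<le> c" using p by (auto intro: sum_nonneg)
  show ?thesis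
  proof (cases "c = 0")
    case True
    then have "\<forall>t\<in>S. p t = 0" "\<forall>t\<in>S. q t = 0"
      using p q S sum_nonneg_eq_0_iff[of S p] sum_nonneg_eq_0_iff[of S q] by auto
    then show ?thesis using True by simp
  next
    case False
    then have c: "c > 0" using c0 by simp
    have pc: "(\<Sum>t\<in>S. p t / c) = 1" and qc: "(\<Sum>t\<in>S. q t / c) = 1"
      using p q c by (simp_all add: sum_divide_distrib[symmetric])
    have 1: "norm ((\<Sum>t\<in>S. (q t / c) *\<^sub>R h t) - h s) \<le> B" if "s \<in> S" for s
      using S q c that B qc by (intro norm_convex_combination_diff_le) auto
    have 2: "norm ((\<Sum>t\<in>S. (p t / c) *\<^sub>R h t) - (\<Sum>t\<in>S. (q t / c) *\<^sub>R h t)) \<le> B"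
      using S p c pc 1 by (intro norm_convex_combination_diff_le) (auto simp: norm_minus_commute)
    have "(\<Sum>t\<in>S. p t *\<^sub>R h t) - (\<Sum>t\<in>S. q t *\<^sub>R h t)
        = c *\<^sub>R ((\<Sum>t\<in>S. (p t / c) *\<^sub>R h t) - (\<Sum>t\<in>S. (q t / c) *\<^sub>R h t))"
      using c by (simp add: scaleR_diff_right scaleR_sum_right)
    then show ?thesis using 2 c by simp
  qed
qed

text \<open>The perturbation enters before the averaging, as in the algorithm, where the local
  gradient step precedes the mixing.\<close>

locale perturbed_row_chain = row_chain S M mb for S :: "'s set" and M mb +
  fixes h u :: "nat \<Rightarrow> 's \<Rightarrow> 'v::real_normed_vector" and U :: "nat \<Rightarrow> real"
  assumes h_step: "\<And>k s. s \<in> S \<Longrightarrow> h (Suc k) s = (\<Sum>t\<in>S. M k s t *\<^sub>R (h k t + u k t))"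
    and u_le: "\<And>k t. t \<in> S \<Longrightarrow> norm (u k t) \<le> U k"
begin

text \<open>Once injected, a perturbation is only averaged, so its sup norm never grows and the
  bounds add up.\<close>

lemma deviation_from_unperturbed:
  assumes "s \<in> S"
  shows "norm (h (k + n) s - (\<Sum>t\<in>S. P k n s t *\<^sub>R h k t)) \<le> (\<Sum>l<n. U (k + l))"
  using assms
proof (induction n arbitrary: s)
  case 0
  have "(\<Sum>t\<in>S. P k 0 s t *\<^sub>R h k t) = (\<Sum>t\<in>S. if s = t then h k t else 0)"
    by (intro sum.cong) auto
  then have "(\<Sum>t\<in>S. P k 0 s t *\<^sub>R h k t) = h k s" using finS 0 by simp
  then show ?case by simp
next
  case (Suc n)
  let ?q = "\<lambda>s. \<Sum>t\<in>S. P k n s t *\<^sub>R h k t"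
  have "(\<Sum>t\<in>S. P k (Suc n) s t *\<^sub>R h k t) = (\<Sum>t\<in>S. \<Sum>v\<in>S. (M (k + n) s v * P k n v t) *\<^sub>R h k t)"
    by (simp add: scaleR_sum_left)
  also have "\<dots> = (\<Sum>v\<in>S. M (k + n) s v *\<^sub>R ?q v)"
    by (subst sum.swap) (simp add: scaleR_sum_right)
  finally have eq: "h (k + Suc n) s - (\<Sum>t\<in>S. P k (Suc n) s t *\<^sub>R h k t)
      = (\<Sum>v\<in>S. M (k + n) s v *\<^sub>R ((h (k + n) v - ?q v) + u (k + n) v))"
    using Suc by (simp add: h_step scaleR_diff_right scaleR_add_right sum_subtractf sum.distrib)
  have "norm ((\<Sum>v\<in>S. M (k + n) s v *\<^sub>R ((h (k + n) v - ?q v) + u (k + n) v)) - 0)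
      \<le> (\<Sum>l<n. U (k + l)) + U (k + n)"
    using finS Suc M_nonneg row_sum u_le
    by (intro norm_convex_combination_diff_le)
       (auto intro!: norm_triangle_le add_mono)
  then show ?case unfolding eq by simp
qed

text \<open>Doeblin's argument: all rows share the mass \<open>\<eta>\<close> at column
  \<open>j\<close>, which cancels in a difference; the two remainders have mass
  \<open>1 - \<eta>\<close>. The factor 2 comes from the perturbation at both nodes.\<close>

lemma pairwise_distance_contraction:
  assumes j: "j \<in> S" and \<eta>: "\<And>s. s \<in> S \<Longrightarrow> \<eta> \<le> P k K s j"
    and B: "\<And>s t. s \<in> S \<Longrightarrow> t \<in> S \<Longrightarrow> norm (h k s - h k t) \<le> B"
    and s: "s \<in> S" and t: "t \<in> S"
  shows "norm (h (k + K) s - h (k + K) t) \<le> (1 - \<eta>) * B + 2 * (\<Sum>l<K. U (k + l))"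
proof -
  let ?q = "\<lambda>s. \<Sum>t\<in>S. P k K s t *\<^sub>R h k t"
  let ?p = "\<lambda>s t. P k K s t - (if t = j then \<eta> else 0)"
  have q: "?q s = (\<Sum>t\<in>S. ?p s t *\<^sub>R h k t) + \<eta> *\<^sub>R h k j" for s
  proof -
    have "(\<Sum>t\<in>S. (if t = j then \<eta> else 0) *\<^sub>R h k t) = (\<Sum>t\<in>S. if t = j then \<eta> *\<^sub>R h k t else 0)"
      by (intro sum.cong) auto
    then show ?thesis using finS j by (simp add: scaleR_diff_left sum_subtractf)
  qed
  have ps: "(\<Sum>t\<in>S. ?p s t) = 1 - \<eta>" if "s \<in> S" for s
    using finS j that by (simp add: sum_subtractf P_row_sum)
  have "norm ((\<Sum>r\<in>S. ?p s r *\<^sub>R h k r) - (\<Sum>r\<in>S. ?p t r *\<^sub>R h k r)) \<le> (1 - \<eta>) * B"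
    using finS s t \<eta> ps B P_nonneg by (intro norm_substochastic_difference_le) auto
  then have "norm (?q s - ?q t) \<le> (1 - \<eta>) * B" by (simp add: q)
  moreover have "h (k + K) s - h (k + K) t
      = (h (k + K) s - ?q s) - (h (k + K) t - ?q t) + (?q s - ?q t)" by simp
  ultimately show ?thesis
    using deviation_from_unperturbed[OF s, of k K] deviation_from_unperturbed[OF t, of k K]
    by (smt (verit) norm_triangle_ineq norm_triangle_ineq4)
qed

definition spread :: "nat \<Rightarrow> real" where
  "spread k = Max ((\<lambda>(s, t). norm (h k s - h k t)) ` (S \<times> S))"

lemma spread_ge: "s \<in> S \<Longrightarrow> t \<in> S \<Longrightarrow> norm (h k s - h k t) \<le> spread k"
  unfolding spread_def using finS by (intro Max_ge) auto

lemma spread_contraction: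
  assumes "j \<in> S" "\<And>s. s \<in> S \<Longrightarrow> \<eta> \<le> P k K s j"
  shows "spread (k + K) \<le> (1 - \<eta>) * spread k + 2 * (\<Sum>l<K. U (k + l))"
proof -
  have "\<forall>a\<in>(\<lambda>(s, t). norm (h (k + K) s - h (k + K) t)) ` (S \<times> S).
      a \<le> (1 - \<eta>) * spread k + 2 * (\<Sum>l<K. U (k + l))"
    using pairwise_distance_contraction[OF assms spread_ge] by auto
  then show ?thesis
    unfolding spread_def[of "k + K"] using assms(1) finS by (subst Max_le_iff) auto
qed

text \<open>The value that the unperturbed chain, started at time k from h k, takes at node s0 at the
  horizon N. It is a convex combination of the current values with weights bounded below, and it
  plays the role of the paper's average with respect to the absolute probability vectors, which
  are the limits of these weights as N tends to infinity.\<close>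
definition forecast :: "nat \<Rightarrow> 's \<Rightarrow> nat \<Rightarrow> 'v" where
  "forecast N s0 k = (\<Sum>t\<in>S. P k (N - k) s0 t *\<^sub>R h k t)"

text \<open>The product up to the horizon factors through \<open>M k\<close>, so an unperturbed step
  leaves the forecast unchanged and only the perturbation, with its forecast weights, moves
  it.\<close>

lemma forecast_step:
  assumes "k < N" "s0 \<in> S"
  shows "forecast N s0 (Suc k) = forecast N s0 k + (\<Sum>t\<in>S. P k (N - k) s0 t *\<^sub>R u k t)"
proof -
  define n where "n = N - Suc k"
  have n: "N - k = 1 + n" using assms by (simp add: n_def)
  have P: "P k (N - k) s0 t = (\<Sum>v\<in>S. P (Suc k) n s0 v * M k v t)" if "t \<in> S" for t
    using assms that unfolding n by (subst P_add) (auto simp: P_1 simp del: mprod.simps intro!: sum.cong)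
  have "forecast N s0 (Suc k)
      = (\<Sum>v\<in>S. P (Suc k) n s0 v *\<^sub>R (\<Sum>t\<in>S. M k v t *\<^sub>R (h k t + u k t)))"
    by (simp add: forecast_def n_def h_step)
  also have "\<dots> = (\<Sum>v\<in>S. \<Sum>t\<in>S. (P (Suc k) n s0 v * M k v t) *\<^sub>R (h k t + u k t))"
    by (simp add: scaleR_sum_right)
  also have "\<dots> = (\<Sum>t\<in>S. \<Sum>v\<in>S. (P (Suc k) n s0 v * M k v t) *\<^sub>R (h k t + u k t))"
    by (rule sum.swap)
  also have "\<dots> = (\<Sum>t\<in>S. P k (N - k) s0 t *\<^sub>R (h k t + u k t))"
    by (intro sum.cong refl) (simp add: P scaleR_sum_left)
  finally show ?thesis by (simp add: forecast_def scaleR_add_right sum.distrib)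
qed

lemma norm_forecast_diff_le:
  assumes "s0 \<in> S" "\<And>t. t \<in> S \<Longrightarrow> norm (h k t - w) \<le> B"
  shows "norm (forecast N s0 k - w) \<le> B"
  unfolding forecast_def using assms finS P_nonneg P_row_sum
  by (intro norm_convex_combination_diff_le) auto

end

section \<open>Column-stochastic products: mass transport and l1 contraction\<close>

locale column_chain = nonneg_chain S M mb for S :: "'s set" and M mb +
  assumes column_sum: "\<And>k t. t \<in> S \<Longrightarrow> (\<Sum>s\<in>S. M k s t) = 1"
begin

lemma P_column_sum: "t \<in> S \<Longrightarrow> (\<Sum>s\<in>S. P k n s t) = 1"
proof (induction n)
  case 0
  then show ?case using finS by simp
next
  case (Suc n)
  have "(\<Sum>s\<in>S. P k (Suc n) s t) = (\<Sum>u\<in>S. \<Sum>s\<in>S. M (k + n) s u * P k n u t)"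
    by (simp, rule sum.swap)
  also have "\<dots> = (\<Sum>u\<in>S. P k n u t)"
    by (simp add: sum_distrib_right[symmetric] column_sum)
  finally show ?case using Suc by simp
qed

lemma P_le_1: "s \<in> S \<Longrightarrow> t \<in> S \<Longrightarrow> P k n s t \<le> 1"
  using P_column_sum[of t k n] member_le_sum[of s S "\<lambda>s. P k n s t"] P_nonneg finS by auto

text \<open>Here the last \<open>K\<close> factors do the work and the earlier ones only preserve
  total mass; hence the bound is assumed at every starting time, unlike for columns of a
  row-stochastic chain.\<close>

lemma P_row_lower_bound:
  assumes "\<And>k u. u \<in> S \<Longrightarrow> \<eta> \<le> P k K j u" "K \<le> n" "t \<in> S" "j \<in> S"
  shows "\<eta> \<le> P k n j t"
proof -
  have "\<eta> = (\<Sum>u\<in>S. \<eta> * P k (n - K) u t)"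
    using P_column_sum[OF assms(3)] by (simp add: sum_distrib_left[symmetric])
  also have "\<dots> \<le> (\<Sum>u\<in>S. P (k + (n - K)) K j u * P k (n - K) u t)"
    using assms by (intro sum_mono mult_right_mono P_nonneg) auto
  also have "\<dots> = P k ((n - K) + K) j t" by (rule P_add[OF assms(4), symmetric])
  finally show ?thesis using assms by simp
qed

end

lemma sum_norm_nonneg_matrix_le:
  fixes e :: "'s \<Rightarrow> 'v::real_normed_vector"
  assumes "\<And>s t. s \<in> S \<Longrightarrow> t \<in> S \<Longrightarrow> 0 \<le> C s t" "\<And>t. t \<in> S \<Longrightarrow> (\<Sum>s\<in>S. C s t) = c"
  shows "(\<Sum>s\<in>S. norm (\<Sum>t\<in>S. C s t *\<^sub>R e t)) \<le> c * (\<Sum>t\<in>S. norm (e t))"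
proof -
  have "(\<Sum>s\<in>S. norm (\<Sum>t\<in>S. C s t *\<^sub>R e t)) \<le> (\<Sum>s\<in>S. \<Sum>t\<in>S. C s t * norm (e t))"
    using assms(1) by (intro sum_mono sum_norm_le) auto
  also have "\<dots> = (\<Sum>t\<in>S. \<Sum>s\<in>S. C s t * norm (e t))" by (rule sum.swap)
  also have "\<dots> = c * (\<Sum>t\<in>S. norm (e t))"
    using assms(2) by (simp add: sum_distrib_right[symmetric] sum_distrib_left)
  finally show ?thesis .
qed

locale perturbed_column_chain = column_chain S M mb for S :: "'s set" and M mb +
  fixes e u :: "nat \<Rightarrow> 's \<Rightarrow> 'v::real_normed_vector" and U :: "nat \<Rightarrow> real"
  assumes e_step: "\<And>k s. s \<in> S \<Longrightarrow> e (Suc k) s = (\<Sum>t\<in>S. M k s t *\<^sub>R (e k t + u k t))"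
    and u_le: "\<And>k. (\<Sum>t\<in>S. norm (u k t)) \<le> U k"
begin

lemma l1_deviation_from_unperturbed:
  "(\<Sum>s\<in>S. norm (e (k + n) s - (\<Sum>t\<in>S. P k n s t *\<^sub>R e k t))) \<le> (\<Sum>l<n. U (k + l))"
proof (induction n)
  case 0
  have "(\<Sum>t\<in>S. P k 0 s t *\<^sub>R e k t) = e k s" if "s \<in> S" for s
  proof -
    have "(\<Sum>t\<in>S. P k 0 s t *\<^sub>R e k t) = (\<Sum>t\<in>S. if s = t then e k t else 0)"
      by (intro sum.cong) auto
    then show ?thesis using finS that by simp
  qed
  then show ?case by simp
next
  case (Suc n)
  let ?q = "\<lambda>s. \<Sum>t\<in>S. P k n s t *\<^sub>R e k t"
  have "e (k + Suc n) s - (\<Sum>t\<in>S. P k (Suc n) s t *\<^sub>R e k t)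
      = (\<Sum>v\<in>S. M (k + n) s v *\<^sub>R ((e (k + n) v - ?q v) + u (k + n) v))" if "s \<in> S" for s
  proof -
    have "(\<Sum>t\<in>S. P k (Suc n) s t *\<^sub>R e k t) = (\<Sum>t\<in>S. \<Sum>v\<in>S. (M (k + n) s v * P k n v t) *\<^sub>R e k t)"
      by (simp add: scaleR_sum_left)
    also have "\<dots> = (\<Sum>v\<in>S. M (k + n) s v *\<^sub>R ?q v)"
      by (subst sum.swap) (simp add: scaleR_sum_right)
    finally show ?thesis
      using that by (simp add: e_step scaleR_diff_right scaleR_add_right sum_subtractf sum.distrib)
  qed
  then have "(\<Sum>s\<in>S. norm (e (k + Suc n) s - (\<Sum>t\<in>S. P k (Suc n) s t *\<^sub>R e k t)))
      = (\<Sum>s\<in>S. norm (\<Sum>v\<in>S. M (k + n) s v *\<^sub>R ((e (k + n) v - ?q v) + u (k + n) v)))"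
    by simp
  also have "\<dots> \<le> 1 * (\<Sum>v\<in>S. norm ((e (k + n) v - ?q v) + u (k + n) v))"
    by (intro sum_norm_nonneg_matrix_le M_nonneg column_sum)
  also have "\<dots> \<le> (\<Sum>v\<in>S. norm (e (k + n) v - ?q v) + norm (u (k + n) v))"
    by (simp add: sum_mono norm_triangle_ineq)
  also have "\<dots> \<le> (\<Sum>l<n. U (k + l)) + U (k + n)"
    using Suc u_le by (simp add: sum.distrib add_mono)
  finally show ?case by simp
qed

text \<open>On a zero-sum vector, subtracting the constant \<open>\<eta>\<close> from row
  \<open>j\<close> changes nothing, but it lowers every column sum to
  \<open>1 - \<eta>\<close>.\<close>

lemma l1_contraction:
  assumes j: "j \<in> S" and \<eta>: "\<And>t. t \<in> S \<Longrightarrow> \<eta> \<le> P k K j t"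
    and zero: "(\<Sum>t\<in>S. e k t) = 0"
  shows "(\<Sum>s\<in>S. norm (e (k + K) s)) \<le> (1 - \<eta>) * (\<Sum>s\<in>S. norm (e k s)) + (\<Sum>l<K. U (k + l))"
proof -
  let ?q = "\<lambda>s. \<Sum>t\<in>S. P k K s t *\<^sub>R e k t"
  let ?p = "\<lambda>s t. P k K s t - (if s = j then \<eta> else 0)"
  have q: "?q s = (\<Sum>t\<in>S. ?p s t *\<^sub>R e k t)" for s
    using zero by (simp add: scaleR_diff_left sum_subtractf scaleR_sum_right[symmetric])
  have "(\<Sum>s\<in>S. norm (?q s)) \<le> (1 - \<eta>) * (\<Sum>s\<in>S. norm (e k s))"
    unfolding q using finS j \<eta> P_nonneg
    by (intro sum_norm_nonneg_matrix_le) (auto simp: sum_subtractf P_column_sum)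
  moreover have "(\<Sum>s\<in>S. norm (e (k + K) s)) \<le> (\<Sum>s\<in>S. norm (e (k + K) s - ?q s) + norm (?q s))"
    by (intro sum_mono) (metis diff_add_cancel norm_triangle_ineq)
  ultimately show ?thesis
    using l1_deviation_from_unperturbed[of k K] by (simp add: sum.distrib)
qed

end

subsection \<open>The augmented consensus chain\<close>

text \<open>The ball around \<open>i\<close> gains a node with each unit of radius until it stalls;
  a stalled ball is closed under \<open>E\<close> and thus everything.\<close>

lemma strongly_connected_relpow_lt_card:
  fixes E :: "('i::finite \<times> 'i) set"
  assumes conn: "\<forall>i j. (i, j) \<in> E\<^sup>*"
  shows "\<exists>n<CARD('i). (i, j) \<in> E ^^ n"
proof -
  define B where "B m = {j. \<exists>n\<le>m. (i, j) \<in> E ^^ n}" for m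
  have B_Suc: "B m \<union> E `` B m \<subseteq> B (Suc m)" for m
    unfolding B_def by (auto intro: le_SucI) (metis Suc_le_mono relpow_Suc_I)
  have grow: "B m = UNIV \<or> Suc m \<le> card (B m)" for m
  proof (induction m)
    case 0
    have "i \<in> B 0" by (auto simp: B_def)
    then have "B 0 \<noteq> {}" by blast
    then show ?case by (auto simp: Suc_le_eq card_gt_0_iff)
  next
    case (Suc m)
    show ?case
    proof (cases "B (Suc m) = B m")
      case True
      then have closed: "E `` B m \<subseteq> B m" using B_Suc[of m] by auto
      have "l \<in> B m" for l
      proof -
        have "(i, l) \<in> E\<^sup>*" using conn by blast
        then show ?thesis
        proof (induction rule: rtrancl_induct)
          case base
          show ?case by (auto simp: B_def intro: exI[of _ 0])
        qed (use closed in auto)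
      qed
      then have "B m = UNIV" by auto
      then show ?thesis using True by simp
    next
      case False
      then have "B m \<subset> B (Suc m)" using B_Suc[of m] by auto
      then have "card (B m) < card (B (Suc m))" by (intro psubset_card_mono) auto
      moreover have "B m \<noteq> UNIV" using \<open>B m \<subset> B (Suc m)\<close> by auto
      ultimately show ?thesis using Suc by auto
    qed
  qed
  have "0 < CARD('i)" by simp
  then have "B (CARD('i) - 1) = UNIV"
    using grow[of "CARD('i) - 1"] card_eq_UNIV_imp_eq_UNIV[of "B (CARD('i) - 1)"]
      card_mono[of UNIV "B (CARD('i) - 1)"] by auto
  then have "j \<in> B (CARD('i) - 1)" by simp
  then obtain n where "n \<le> CARD('i) - 1" "(i, j) \<in> E ^^ n" by (auto simp: B_def)
  moreover then have "n < CARD('i)" using \<open>0 < CARD('i)\<close> by linarith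
  ultimately show ?thesis by blast
qed

locale async_network =
  fixes E :: "('i::finite \<times> 'i) set" and mbar :: real and ik :: "nat \<Rightarrow> 'i" and T D :: nat
    and tau :: "nat \<Rightarrow> 'i \<Rightarrow> 'i \<Rightarrow> int"
  assumes no_loops: "\<And>i. (i, i) \<notin> E"
    and strongly_conn: "\<forall>i j. (i, j) \<in> E\<^sup>*"
    and mbar: "0 < mbar" "mbar < 1"
    and act: "\<And>k i. \<exists>t. k \<le> t \<and> t < k + T \<and> ik t = i"
    and tau_ge: "\<And>k j. (j, ik k) \<in> E \<Longrightarrow> int k - int D \<le> tau k (ik k) j"
    and tau_le: "\<And>k j. (j, ik k) \<in> E \<Longrightarrow> tau k (ik k) j \<le> int k"
begin

text \<open>Cost of crossing one edge: at most T steps until the tail is active and releases its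
  value, D steps of delay, T steps until the head is active.\<close>

definition hop :: nat where "hop = 2 * T + D"

definition K1 :: nat where "K1 = (2 * CARD('i) - 1) * T + CARD('i) * D"

text \<open>At most \<open>CARD('i) - 1\<close> hops along a path; the extra \<open>T + D\<close>
  lets a value spread from x_j to all its stored copies, or lets mass in transit arrive at the head
  of its edge.\<close>

lemma K1_eq: "K1 = (CARD('i) - 1) * hop + T + D"
proof -
  obtain n where n: "CARD('i) = Suc n"
    by (metis finite_UNIV_card_ge_0 finite gr0_implies_Suc)
  show ?thesis unfolding K1_def hop_def n by (simp add: algebra_simps)
qed

end

locale consensus_network = async_network E mbar ik T D tau
  for E :: "('i::finite \<times> 'i) set" and mbar ik T D tau +
  fixes W :: "'i \<Rightarrow> 'i \<Rightarrow> real"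
  assumes W_row: "\<forall>i. (\<Sum>j\<in>UNIV. W i j) = 1" and W_pat: "weight_pattern E mbar W"
begin

text \<open>The node (i, 0) carries x_i and the node (i, Suc a) carries v_i as it was a steps ago.\<close>
definition cS :: "('i \<times> nat) set" where "cS = UNIV \<times> {..Suc D}"

definition lag :: "nat \<Rightarrow> 'i \<Rightarrow> 'i \<Rightarrow> nat" where "lag k i j = nat (int k - tau k i j)"

lemma lag_le: "(j, ik k) \<in> E \<Longrightarrow> lag k (ik k) j \<le> D"
  using tau_ge[of j k] by (simp add: lag_def)

lemma of_nat_lag: "(j, ik k) \<in> E \<Longrightarrow> int k - int (lag k (ik k) j) = tau k (ik k) j"
  using tau_le[of j k] by (simp add: lag_def)

text \<open>Mixing acts after the perturbation \<open>uc\<close> has turned the entry at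
  \<open>(ik k, 0)\<close> from x into the new v. Hence the diagonal weight sits on
  \<open>(i, 0)\<close> itself, and the newest copy \<open>(i, Suc 0)\<close> is refreshed from that
  node.\<close>

fun cM :: "nat \<Rightarrow> 'i \<times> nat \<Rightarrow> 'i \<times> nat \<Rightarrow> real" where
  "cM k (i, 0) (j, 0) = (if j = i then (if i = ik k then W i i else 1) else 0)"
| "cM k (i, 0) (j, Suc a) = (if i = ik k \<and> (j, i) \<in> E \<and> a = lag k i j then W i j else 0)"
| "cM k (i, Suc 0) t = (if t = (i, if i = ik k then 0 else 1) then 1 else 0)"
| "cM k (i, Suc (Suc a)) t = (if t = (i, Suc a) then 1 else 0)"

lemma W_ge: "mbar \<le> W i i" "(j, i) \<in> E \<Longrightarrow> mbar \<le> W i j" "i \<noteq> j \<Longrightarrow> (j, i) \<notin> E \<Longrightarrow> W i j = 0"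
  using W_pat by (auto simp: weight_pattern_def)

lemma W_split: "W i i + (\<Sum>j | (j, i) \<in> E. W i j) = 1"
proof -
  have "(\<Sum>j\<in>UNIV. W i j) = (\<Sum>j\<in>insert i {j. (j, i) \<in> E}. W i j)"
    by (intro sum.mono_neutral_right) (use W_ge(3)[of i] in \<open>force+\<close>)
  then show ?thesis using W_row no_loops by simp
qed

text \<open>A general argument \<open>\<phi>\<close> lets one identity yield both the row sums
  (constant 1) and the recursion of the run.\<close>

lemma cM_x_apply:
  fixes \<phi> :: "'i \<times> nat \<Rightarrow> 'v::real_vector"
  shows "(\<Sum>t\<in>cS. cM k (i, 0) t *\<^sub>R \<phi> t) =
    (if i = ik k then W i i *\<^sub>R \<phi> (i, 0) + (\<Sum>j | (j, i) \<in> E. W i j *\<^sub>R \<phi> (j, Suc (lag k i j)))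
     else \<phi> (i, 0))"
proof -
  have inner: "(\<Sum>m\<le>Suc D. cM k (i, 0) (j, m) *\<^sub>R \<phi> (j, m)) =
     (if j = i then (if i = ik k then W i i else 1) *\<^sub>R \<phi> (i, 0) else 0)
     + (if i = ik k \<and> (j, i) \<in> E then W i j *\<^sub>R \<phi> (j, Suc (lag k i j)) else 0)" for j
  proof -
    have "(\<Sum>m\<le>D. cM k (i, 0) (j, Suc m) *\<^sub>R \<phi> (j, Suc m)) =
        (\<Sum>m\<le>D. if m = lag k i j then
            (if i = ik k \<and> (j, i) \<in> E then W i j *\<^sub>R \<phi> (j, Suc m) else 0) else 0)"
      by (intro sum.cong) auto
    also have "\<dots> = (if i = ik k \<and> (j, i) \<in> E then W i j *\<^sub>R \<phi> (j, Suc (lag k i j)) else 0)"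
      using lag_le by auto
    finally show ?thesis by (subst sum.atMost_Suc_shift) auto
  qed
  have "(\<Sum>t\<in>cS. cM k (i, 0) t *\<^sub>R \<phi> t) = (\<Sum>j\<in>UNIV. \<Sum>m\<le>Suc D. cM k (i, 0) (j, m) *\<^sub>R \<phi> (j, m))"
    unfolding cS_def by (subst sum.cartesian_product) (simp add: case_prod_beta)
  also have "\<dots> = (if i = ik k then W i i else 1) *\<^sub>R \<phi> (i, 0)
      + (\<Sum>j\<in>UNIV. if i = ik k \<and> (j, i) \<in> E then W i j *\<^sub>R \<phi> (j, Suc (lag k i j)) else 0)"
    unfolding inner by (simp add: sum.distrib)
  finally show ?thesis by (simp add: sum.If_cases)
qed

lemma cM_delta_apply:
  fixes \<phi> :: "'i \<times> nat \<Rightarrow> 'v::real_vector"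
  assumes "\<And>t. t \<in> cS \<Longrightarrow> cM k s t = (if t = r then 1 else 0)" "r \<in> cS"
  shows "(\<Sum>t\<in>cS. cM k s t *\<^sub>R \<phi> t) = \<phi> r"
proof -
  have "(\<Sum>t\<in>cS. cM k s t *\<^sub>R \<phi> t) = (\<Sum>t\<in>cS. if t = r then \<phi> t else 0)"
    using assms(1) by (intro sum.cong) auto
  also have "\<dots> = \<phi> r" using assms(2) by (subst sum.delta) (auto simp: cS_def)
  finally show ?thesis .
qed

lemma cM_v_apply:
  fixes \<phi> :: "'i \<times> nat \<Rightarrow> 'v::real_vector"
  shows "(\<Sum>t\<in>cS. cM k (i, Suc 0) t *\<^sub>R \<phi> t) = \<phi> (i, if i = ik k then 0 else 1)"
  by (rule cM_delta_apply) (auto simp: cS_def)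

lemma cM_shift_apply:
  fixes \<phi> :: "'i \<times> nat \<Rightarrow> 'v::real_vector"
  shows "Suc a \<le> D \<Longrightarrow> (\<Sum>t\<in>cS. cM k (i, Suc (Suc a)) t *\<^sub>R \<phi> t) = \<phi> (i, Suc a)"
  by (rule cM_delta_apply) (auto simp: cS_def)

lemma cM_nonneg: "0 \<le> cM k s t"
  using order_trans[OF less_imp_le[OF mbar(1)] W_ge(1)] order_trans[OF less_imp_le[OF mbar(1)] W_ge(2)]
  by (cases "(k, s, t)" rule: cM.cases) auto

lemma cM_row_sum:
  assumes "s \<in> cS"
  shows "(\<Sum>t\<in>cS. cM k s t) = 1"
proof -
  obtain i m where s: "s = (i, m)" "m \<le> Suc D" using assms by (auto simp: cS_def)
  consider "m = 0" | "m = Suc 0" | a where "m = Suc (Suc a)" "Suc a \<le> D"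
    using s by (cases m rule: nat.exhaust; cases "m - 1") auto
  then show ?thesis
  proof cases
    case 1
    then show ?thesis using cM_x_apply[of k i "\<lambda>_. 1::real"] W_split s by auto
  next
    case 2
    then show ?thesis using cM_v_apply[of k i "\<lambda>_. 1::real"] s by auto
  next
    case 3
    then show ?thesis using cM_shift_apply[of a k i "\<lambda>_. 1::real"] s by auto
  qed
qed

sublocale C: row_chain cS cM mbar
  using mbar cM_nonneg cM_row_sum by unfold_locales (auto simp: cS_def)

lemma reach_x_persist:
  "C.reach k n t (i, 0) \<Longrightarrow> n \<le> n' \<Longrightarrow> C.reach k n' t (i, 0)"
  by (rule C.reach_persist) (use W_ge mbar in auto)

text \<open>An activation copies the value from \<open>(i, 0)\<close>. Afterwards the newest copy is
  either kept or refreshed from \<open>(i, 0)\<close>, which is still reached.\<close>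

lemma reach_x_v0:
  assumes x: "C.reach k n t (i, 0)" and n': "n + T \<le> n'"
  shows "C.reach k n' t (i, Suc 0)"
proof -
  obtain t0 where t0: "k + n \<le> t0" "t0 < k + n + T" "ik t0 = i" using act by blast
  have "Suc (t0 - k) \<le> n'" using t0 n' by linarith
  then show ?thesis
  proof (induction rule: dec_induct)
    case base
    have "C.reach k (t0 - k) t (i, 0)" using t0 by (intro reach_x_persist[OF x]) linarith
    then show ?case using t0 mbar by (intro C.reach_step) (auto simp: cS_def)
  next
    case (step m)
    have "C.reach k m t (i, 0)" using t0 step by (intro reach_x_persist[OF x]) linarith
    then have "C.reach k m t (i, if i = ik (k + m) then 0 else 1)" using step.IH by (cases "i = ik (k + m)") auto
    then show ?case using mbar by - (rule C.reach_step, auto simp: cS_def)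
  qed
qed

lemma reach_x_v:
  assumes "C.reach k n t (i, 0)" "n + T + a \<le> n'" "a \<le> D"
  shows "C.reach k n' t (i, Suc a)"
  using assms(2,3)
proof (induction a arbitrary: n')
  case 0
  then show ?case using reach_x_v0[OF assms(1)] by simp
next
  case (Suc a)
  then obtain m where m: "n' = Suc m" by (cases n') auto
  have "C.reach k m t (i, Suc a)" using Suc m by simp
  then show ?case unfolding m using mbar Suc.prems by (intro C.reach_step) (auto simp: cS_def)
qed

text \<open>After \<open>T + D\<close> steps all \<open>D + 1\<close> stored copies at the tail are
  reached, so the next activation of the head succeeds whichever copy it reads.\<close>

lemma reach_neighbour:
  assumes x: "C.reach k n t (j, 0)" and e: "(j, l) \<in> E"
  shows "C.reach k (n + hop) t (l, 0)"
proof -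
  obtain t0 where t0: "k + n + T + D \<le> t0" "t0 < k + n + T + D + T" "ik t0 = l" using act by blast
  define m where "m = t0 - k"
  have m: "t0 = k + m" using t0 by (simp add: m_def)
  have "lag t0 l j \<le> D" using lag_le[of j t0] t0 e by simp
  then have "C.reach k m t (j, Suc (lag t0 l j))"
    using t0 m by (intro reach_x_v[OF x]) linarith+
  then have "C.reach k (Suc m) t (l, 0)"
    by (rule C.reach_step) (use t0 m e W_ge in \<open>auto simp: cS_def\<close>)
  then show ?thesis by (rule reach_x_persist) (use t0 m in \<open>simp add: hop_def\<close>)
qed

lemma reach_relpow: "(i, j) \<in> E ^^ m \<Longrightarrow> C.reach k (m * hop) (i, 0) (j, 0)"
proof (induction m arbitrary: j)
  case 0
  then show ?case using C.reach_refl by (auto simp: cS_def)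
next
  case (Suc m)
  then obtain l where "(i, l) \<in> E ^^ m" "(l, j) \<in> E" by auto
  then show ?case using reach_neighbour[OF Suc.IH] by (simp add: add.commute)
qed

lemma P_column_ge:
  assumes "s \<in> cS"
  shows "mbar ^ K1 \<le> C.P k K1 s (i, 0)"
proof -
  obtain j a where s: "s = (j, a)" "a \<le> Suc D" using assms by (auto simp: cS_def)
  obtain m where m: "m < CARD('i)" "(i, j) \<in> E ^^ m"
    using strongly_connected_relpow_lt_card[OF strongly_conn] by blast
  have "m * hop \<le> (CARD('i) - 1) * hop" using m by (intro mult_right_mono) auto
  then have x: "C.reach k ((CARD('i) - 1) * hop) (i, 0) (j, 0)"
    using reach_relpow[OF m(2)] reach_x_persist by blast
  have "C.reach k K1 (i, 0) s"
    using s reach_x_persist[OF x, of K1] reach_x_v[OF x, of _ K1] by (cases a) (auto simp: K1_eq)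
  then show ?thesis by (simp add: C.reach_def)
qed

end

subsection \<open>The augmented tracking chain\<close>

locale tracking_network = async_network E mbar ik T D tau
  for E :: "('i::finite \<times> 'i) set" and mbar ik T D tau +
  fixes A :: "'i \<Rightarrow> 'i \<Rightarrow> real"
  assumes A_col: "\<forall>j. (\<Sum>i\<in>UNIV. A i j) = 1" and A_pat: "weight_pattern E mbar A"
begin

text \<open>The node Inl i carries z_i; the node Inr (e, a) carries the mass of age a on the edge e that
  the head of e has not yet received, ages above D being lumped together at a = Suc D.\<close>
definition tS :: "('i + ('i \<times> 'i) \<times> nat) set" where
  "tS = UNIV <+> (E \<times> {..Suc D})"

text \<open>Mass of age \<open>a\<close> was written at time \<open>k - a\<close>, while
  \<open>tau k\<close> is the read index after its update in iteration \<open>k\<close>.\<close>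

definition received :: "nat \<Rightarrow> 'i \<times> 'i \<Rightarrow> nat \<Rightarrow> bool" where
  "received k e a \<longleftrightarrow> snd e = ik k \<and> int k - int a \<le> tau k (snd e) (fst e)"

fun push :: "'i \<Rightarrow> 'i + ('i \<times> 'i) \<times> nat \<Rightarrow> real" where
  "push i (Inl l) = (if l = i then A i i else 0)"
| "push i (Inr (e, a)) = (if fst e = i \<and> a = 0 then A (snd e) i else 0)"

text \<open>Easiest by columns: the active agent merges all newly received mass with its own before
  splitting it, so these columns all equal \<open>push\<close>; everything else stays put or ages by
  one step.\<close>

fun tM :: "nat \<Rightarrow> 'i + ('i \<times> 'i) \<times> nat \<Rightarrow> 'i + ('i \<times> 'i) \<times> nat \<Rightarrow> real" where
  "tM k s (Inl l) = (if l = ik k then push (ik k) s else if s = Inl l then 1 else 0)"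
| "tM k s (Inr (e, a)) = (if received k e a then push (ik k) s
     else if s = Inr (e, min (Suc a) (Suc D)) then 1 else 0)"

lemma A_ge: "mbar \<le> A i i" "(j, i) \<in> E \<Longrightarrow> mbar \<le> A i j" "i \<noteq> j \<Longrightarrow> (j, i) \<notin> E \<Longrightarrow> A i j = 0"
  using A_pat by (auto simp: weight_pattern_def)

lemma sum_tS: "(\<Sum>t\<in>tS. f t) = (\<Sum>i\<in>UNIV. f (Inl i)) + (\<Sum>e\<in>E. \<Sum>a\<le>Suc D. f (Inr (e, a)))"
  unfolding tS_def
  by (subst sum.Plus) (simp_all add: sum.cartesian_product[symmetric] sum.Sigma case_prod_beta o_def
        del: sum.atMost_Suc)

lemma push_nonneg: "s \<in> tS \<Longrightarrow> 0 \<le> push i s"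
  using order_trans[OF less_imp_le[OF mbar(1)] A_ge(1)] order_trans[OF less_imp_le[OF mbar(1)] A_ge(2)]
  by (cases "(i, s)" rule: push.cases) (auto simp: tS_def)

lemma sum_edges_from:
  fixes \<phi> :: "'i \<times> 'i \<Rightarrow> 'v::comm_monoid_add"
  shows "(\<Sum>e\<in>E. if fst e = i then \<phi> e else 0) = (\<Sum>j | (i, j) \<in> E. \<phi> (i, j))"
proof -
  have "(\<Sum>e\<in>E. if fst e = i then \<phi> e else 0) = (\<Sum>e\<in>Pair i ` {j. (i, j) \<in> E}. \<phi> e)"
    by (intro sum.mono_neutral_cong_right) auto
  also have "\<dots> = (\<Sum>j | (i, j) \<in> E. \<phi> (i, j))"
    by (subst sum.reindex) (auto intro: inj_onI)
  finally show ?thesis .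
qed

lemma sum_edges_to:
  fixes \<phi> :: "'i \<times> 'i \<Rightarrow> 'v::comm_monoid_add"
  shows "(\<Sum>e\<in>E. if snd e = i then \<phi> e else 0) = (\<Sum>j | (j, i) \<in> E. \<phi> (j, i))"
proof -
  have "(\<Sum>e\<in>E. if snd e = i then \<phi> e else 0) = (\<Sum>e\<in>(\<lambda>j. (j, i)) ` {j. (j, i) \<in> E}. \<phi> e)"
    by (intro sum.mono_neutral_cong_right) auto
  also have "\<dots> = (\<Sum>j | (j, i) \<in> E. \<phi> (j, i))"
    by (subst sum.reindex) (auto intro: inj_onI)
  finally show ?thesis .
qed

lemma push_sum: "(\<Sum>s\<in>tS. push i s) = 1"
proof -
  have "(\<Sum>a\<le>Suc D. push i (Inr (e, a))) = (if fst e = i then A (snd e) i else 0)" for e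
    by (subst sum.atMost_Suc_shift) simp
  then have "(\<Sum>s\<in>tS. push i s) = A i i + (\<Sum>e\<in>E. if fst e = i then A (snd e) i else 0)"
    by (simp add: sum_tS del: sum.atMost_Suc)
  also have "\<dots> = A i i + (\<Sum>j | (i, j) \<in> E. A j i)"
    by (simp add: sum_edges_from)
  also have "\<dots> = (\<Sum>j\<in>insert i {j. (i, j) \<in> E}. A j i)" using no_loops by simp
  also have "\<dots> = (\<Sum>j\<in>UNIV. A j i)"
    by (intro sum.mono_neutral_left) (use A_ge(3)[of _ i] in \<open>force+\<close>)
  finally show ?thesis using A_col by simp
qed

lemma tM_nonneg: "s \<in> tS \<Longrightarrow> 0 \<le> tM k s t"
  using push_nonneg[of s "ik k"] by (cases "(k, s, t)" rule: tM.cases) auto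

lemma finite_tS: "finite tS"
  by (simp add: tS_def)

lemma tM_column_sum:
  assumes "t \<in> tS"
  shows "(\<Sum>s\<in>tS. tM k s t) = 1"
proof (cases t)
  case (Inl l)
  then show ?thesis using assms by (cases "l = ik k") (auto simp: push_sum finite_tS)
next
  case (Inr p)
  obtain e a where p: "p = (e, a)" by (cases p)
  then have "Inr (e, min (Suc a) (Suc D)) \<in> tS" using assms Inr by (auto simp: tS_def)
  then show ?thesis unfolding Inr p by (cases "received k e a") (simp_all add: push_sum finite_tS)
qed

sublocale Q: column_chain tS tM mbar
  using mbar tM_nonneg tM_column_sum finite_tS by unfold_locales auto

text \<open>The row form needed to match the run: the collected total times the share
  \<open>push\<close>, plus the mass that the active agent did not touch.\<close>

lemma tM_apply:
  fixes \<phi> :: "'i + ('i \<times> 'i) \<times> nat \<Rightarrow> 'v::real_vector"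
  shows "(\<Sum>t\<in>tS. tM k s t *\<^sub>R \<phi> t) =
     push (ik k) s *\<^sub>R (\<phi> (Inl (ik k))
        + (\<Sum>j | (j, ik k) \<in> E. \<Sum>a\<le>Suc D. if received k (j, ik k) a then \<phi> (Inr ((j, ik k), a)) else 0))
     + (case s of Inl l \<Rightarrow> if l = ik k then 0 else \<phi> (Inl l)
        | Inr (e, b) \<Rightarrow> if e \<in> E then \<Sum>a\<le>Suc D. if \<not> received k e a \<and> b = min (Suc a) (Suc D)
            then \<phi> (Inr (e, a)) else 0 else 0)"
proof -
  let ?i = "ik k" and ?p = "push (ik k) s"
  let ?rec = "\<lambda>e. \<Sum>a\<le>Suc D. if received k e a then \<phi> (Inr (e, a)) else 0"
  let ?keep = "\<lambda>e a. if \<not> received k e a \<and> s = Inr (e, min (Suc a) (Suc D)) then \<phi> (Inr (e, a)) else 0"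
  have 1: "(\<Sum>l\<in>UNIV. tM k s (Inl l) *\<^sub>R \<phi> (Inl l)) =
      ?p *\<^sub>R \<phi> (Inl ?i) + (case s of Inl l \<Rightarrow> if l = ?i then 0 else \<phi> (Inl l) | Inr _ \<Rightarrow> 0)"
  proof -
    have "(\<Sum>l\<in>UNIV. tM k s (Inl l) *\<^sub>R \<phi> (Inl l)) =
        (\<Sum>l\<in>UNIV. (if l = ?i then ?p *\<^sub>R \<phi> (Inl l) else 0) + (if l \<noteq> ?i \<and> s = Inl l then \<phi> (Inl l) else 0))"
      by (intro sum.cong) auto
    also have "\<dots> = ?p *\<^sub>R \<phi> (Inl ?i) + (\<Sum>l\<in>UNIV. if l \<noteq> ?i \<and> s = Inl l then \<phi> (Inl l) else 0)"
      by (simp add: sum.distrib)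
    also have "(\<Sum>l\<in>UNIV. if l \<noteq> ?i \<and> s = Inl l then \<phi> (Inl l) else 0)
        = (case s of Inl l \<Rightarrow> if l = ?i then 0 else \<phi> (Inl l) | Inr _ \<Rightarrow> 0)"
    proof (cases s)
      case (Inl m)
      have "(\<Sum>l\<in>UNIV. if l \<noteq> ?i \<and> s = Inl l then \<phi> (Inl l) else 0)
          = (\<Sum>l\<in>UNIV. if l = m then (if m = ?i then 0 else \<phi> (Inl m)) else 0)"
        by (intro sum.cong) (auto simp: Inl)
      then show ?thesis by (simp add: Inl)
    qed auto
    finally show ?thesis .
  qed
  have "(\<Sum>a\<le>Suc D. tM k s (Inr (e, a)) *\<^sub>R \<phi> (Inr (e, a))) = ?p *\<^sub>R ?rec e + (\<Sum>a\<le>Suc D. ?keep e a)" for e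
    unfolding scaleR_sum_right sum.distrib[symmetric] by (intro sum.cong) auto
  then have 2: "(\<Sum>e\<in>E. \<Sum>a\<le>Suc D. tM k s (Inr (e, a)) *\<^sub>R \<phi> (Inr (e, a)))
      = ?p *\<^sub>R (\<Sum>e\<in>E. ?rec e) + (\<Sum>e\<in>E. \<Sum>a\<le>Suc D. ?keep e a)"
    by (simp only: sum.distrib scaleR_sum_right)
  have 3: "(\<Sum>e\<in>E. ?rec e) = (\<Sum>j | (j, ?i) \<in> E. ?rec (j, ?i))"
  proof -
    have "(\<Sum>e\<in>E. ?rec e) = (\<Sum>e\<in>E. if snd e = ?i then ?rec e else 0)"
      by (intro sum.cong refl) (auto simp: received_def)
    then show ?thesis by (simp only: sum_edges_to)
  qed
  have 4: "(\<Sum>e\<in>E. \<Sum>a\<le>Suc D. ?keep e a) = (case s of Inl l \<Rightarrow> 0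
      | Inr (e, b) \<Rightarrow> if e \<in> E then \<Sum>a\<le>Suc D. if \<not> received k e a \<and> b = min (Suc a) (Suc D)
            then \<phi> (Inr (e, a)) else 0 else 0)"
  proof (cases s)
    case (Inr p)
    obtain e b where p: "p = (e, b)" by (cases p)
    have "(\<Sum>e'\<in>E. \<Sum>a\<le>Suc D. ?keep e' a) = (\<Sum>e'\<in>E. if e' = e then
        \<Sum>a\<le>Suc D. if \<not> received k e a \<and> b = min (Suc a) (Suc D) then \<phi> (Inr (e, a)) else 0 else 0)"
      by (intro sum.cong refl) (auto simp: Inr p intro!: sum.neutral sum.cong simp del: sum.atMost_Suc)
    then show ?thesis by (simp add: Inr p sum.delta del: sum.atMost_Suc)
  qed simp
  show ?thesis
    unfolding sum_tS 1 2 3 4 by (simp add: scaleR_add_right split: sum.split prod.split del: sum.atMost_Suc)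
qed

lemma reach_z_persist: "Q.reach k n t (Inl i) \<Longrightarrow> n \<le> n' \<Longrightarrow> Q.reach k n' t (Inl i)"
  by (rule Q.reach_persist) (use A_ge mbar in auto)

text \<open>After D steps the mass has age at least D, and the delay bound forces the head to take
  it at its next activation, if it has not been taken before.\<close>

lemma reach_edge_head:
  assumes t: "Inr ((j, i), a) \<in> tS" and n: "D + T \<le> n"
  shows "Q.reach k n (Inr ((j, i), a)) (Inl i)"
proof -
  let ?t = "Inr ((j, i), a)"
  have e: "(j, i) \<in> E" "a \<le> Suc D" using t by (auto simp: tS_def)
  have z: "Q.reach k (Suc m) ?t (Inl i)"
    if "Q.reach k m ?t (Inr ((j, i), b))" "received (k + m) (j, i) b" for m b
    using that by (intro Q.reach_step[OF that(1)]) (auto simp: tS_def received_def A_ge)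
  \<comment> \<open>An alternative is carried along because reception may happen early; mass that
    has reached the head keeps enough weight there.\<close>
  have travel: "Q.reach k m ?t (Inr ((j, i), min (a + m) (Suc D))) \<or> Q.reach k m ?t (Inl i)" for m
  proof (induction m)
    case 0
    then show ?case using Q.reach_refl[OF t, of k] e by (simp add: min_absorb1)
  next
    case (Suc m)
    show ?case
    proof (cases "Q.reach k m ?t (Inl i)")
      case True
      then show ?thesis using reach_z_persist by (meson le_SucI order_refl)
    next
      case False
      let ?b = "min (a + m) (Suc D)"
      have b: "Q.reach k m ?t (Inr ((j, i), ?b))" using Suc False by blast
      show ?thesis
      proof (cases "received (k + m) (j, i) ?b")
        case True
        then show ?thesis using z b by blast
      next
        case nr: False
        have "min (Suc ?b) (Suc D) = min (a + Suc m) (Suc D)" by auto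
        then have "mbar \<le> tM (k + m) (Inr ((j, i), min (a + Suc m) (Suc D))) (Inr ((j, i), ?b))"
          using nr mbar by simp
        moreover have "Inr ((j, i), min (a + Suc m) (Suc D)) \<in> tS" using e by (auto simp: tS_def)
        ultimately show ?thesis using Q.reach_step[OF b] by blast
      qed
    qed
  qed
  obtain t0 where t0: "k + D \<le> t0" "t0 < k + D + T" "ik t0 = i" using act by blast
  define m where "m = t0 - k"
  have m: "t0 = k + m" "D \<le> m" "Suc m \<le> n" using t0 n by (auto simp: m_def)
  have "Q.reach k (Suc m) ?t (Inl i)"
  proof (cases "Q.reach k m ?t (Inl i)")
    case True
    then show ?thesis using reach_z_persist by (meson le_SucI order_refl)
  next
    case False
    have "received (k + m) (j, i) (min (a + m) (Suc D))"
      using tau_ge[of j t0] e t0 m by (auto simp: received_def)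
    then show ?thesis using z travel[of m] False by blast
  qed
  then show ?thesis using reach_z_persist m by blast
qed

lemma reach_z_neighbour:
  assumes x: "Q.reach k n t (Inl j)" and e: "(j, l) \<in> E"
  shows "Q.reach k (n + hop) t (Inl l)"
proof -
  obtain t0 where t0: "k + n \<le> t0" "t0 < k + n + T" "ik t0 = j" using act by blast
  define m where "m = t0 - k"
  have m: "t0 = k + m" "n \<le> m" "m < n + T" using t0 by (auto simp: m_def)
  have s: "Inr ((j, l), 0) \<in> tS" using e by (auto simp: tS_def)
  have "Q.reach k m t (Inl j)" using reach_z_persist[OF x m(2)] .
  then have 1: "Q.reach k (Suc m) t (Inr ((j, l), 0))"
    by (rule Q.reach_step) (use t0 m e A_ge s in auto)
  have "Q.reach (k + Suc m) (n + hop - Suc m) (Inr ((j, l), 0)) (Inl l)"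
    by (rule reach_edge_head[OF s]) (use m in \<open>simp add: hop_def\<close>)
  from Q.reach_trans[OF 1 this] show ?thesis using m by (simp add: hop_def)
qed

lemma reach_z_relpow: "(i, j) \<in> E ^^ m \<Longrightarrow> Q.reach k (m * hop) (Inl i) (Inl j)"
proof (induction m arbitrary: j)
  case 0
  then show ?case using Q.reach_refl by (auto simp: tS_def)
next
  case (Suc m)
  then obtain l where "(i, l) \<in> E ^^ m" "(l, j) \<in> E" by auto
  then show ?case using reach_z_neighbour[OF Suc.IH] by (simp add: add.commute)
qed

lemma P_row_ge:
  assumes "t \<in> tS"
  shows "mbar ^ K1 \<le> Q.P k K1 (Inl i) t"
proof -
  obtain l where l: "Q.reach k (D + T) t (Inl l)"
  proof (cases t)
    case (Inl l)
    then show ?thesis using that[of l] reach_z_persist[OF Q.reach_refl[of "Inl l" k]] assms by simp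
  next
    case (Inr p)
    obtain j l a where "p = ((j, l), a)" by (metis surj_pair)
    then show ?thesis using that reach_edge_head assms Inr by blast
  qed
  obtain m where m: "m < CARD('i)" "(l, i) \<in> E ^^ m"
    using strongly_connected_relpow_lt_card[OF strongly_conn] by blast
  have "m * hop \<le> (CARD('i) - 1) * hop" using m by (intro mult_right_mono) auto
  then have "Q.reach (k + (D + T)) ((CARD('i) - 1) * hop) (Inl l) (Inl i)"
    using reach_z_relpow[OF m(2)] reach_z_persist by blast
  from Q.reach_trans[OF l this] have "Q.reach k K1 t (Inl i)"
    by (simp add: K1_eq ac_simps)
  then show ?thesis by (simp add: Q.reach_def)
qed

end

subsection \<open>Inexact gradient steps and the small-gain argument\<close>

text \<open>Divide the convexity inequality along the segment from \<open>x\<close> to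
  \<open>y\<close> by the parameter \<open>t\<close> and let \<open>t\<close> tend to 0 from the
  right.\<close>

lemma strongly_convex_gradient_ge:
  fixes F :: "'v::real_inner \<Rightarrow> real"
  assumes sc: "strongly_convex tc F" and der: "(F has_derivative (\<lambda>h. G \<bullet> h)) (at x)"
  shows "F x + G \<bullet> (y - x) + tc / 2 * (norm (x - y))\<^sup>2 \<le> F y"
proof -
  let ?q = "\<lambda>t::real. (F (x + t *\<^sub>R (y - x)) - F x) / t"
  have "((\<lambda>t::real. x + t *\<^sub>R (y - x)) has_derivative (\<lambda>t. t *\<^sub>R (y - x))) (at 0)"
    by (auto intro!: derivative_eq_intros)
  from has_derivative_compose[OF this, of F "\<lambda>h. G \<bullet> h"] der
  have "((\<lambda>t. F (x + t *\<^sub>R (y - x))) has_derivative (\<lambda>t. (G \<bullet> (y - x)) * t)) (at 0)"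
    by (simp add: mult.commute)
  then have "((\<lambda>t. F (x + t *\<^sub>R (y - x))) has_real_derivative G \<bullet> (y - x)) (at 0)"
    by (simp add: has_field_derivative_def)
  then have "(?q \<longlongrightarrow> G \<bullet> (y - x)) (at 0)"
    by (simp add: has_field_derivative_iff)
  then have lim: "(?q \<longlongrightarrow> G \<bullet> (y - x)) (at_right 0)"
    by (rule filterlim_mono) (auto simp: at_le)
  have lim2: "((\<lambda>t. F y - F x - tc / 2 * (1 - t) * (norm (x - y))\<^sup>2) \<longlongrightarrow>
      F y - F x - tc / 2 * (1 - 0) * (norm (x - y))\<^sup>2) (at_right 0)"
    by (intro tendsto_intros)
  have "eventually (\<lambda>t. ?q t \<le> F y - F x - tc / 2 * (1 - t) * (norm (x - y))\<^sup>2) (at_right (0::real))"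
  proof -
    have "?q t \<le> F y - F x - tc / 2 * (1 - t) * (norm (x - y))\<^sup>2" if t: "0 < t" "t < 1" for t
    proof -
      have "F (t *\<^sub>R y + (1 - t) *\<^sub>R x) \<le> t * F y + (1 - t) * F x - tc / 2 * t * (1 - t) * (norm (y - x))\<^sup>2"
        using sc t unfolding strongly_convex_def by (meson less_imp_le)
      moreover have "t *\<^sub>R y + (1 - t) *\<^sub>R x = x + t *\<^sub>R (y - x)" by (simp add: algebra_simps)
      ultimately have "F (x + t *\<^sub>R (y - x)) - F x
          \<le> (F y - F x - tc / 2 * (1 - t) * (norm (x - y))\<^sup>2) * t"
        by (simp add: algebra_simps norm_minus_commute)
      then show ?thesis using t by (simp add: pos_divide_le_eq)
    qed
    then show ?thesis unfolding eventually_at_right_field by (metis zero_less_one)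
  qed
  then have "G \<bullet> (y - x) \<le> F y - F x - tc / 2 * (1 - 0) * (norm (x - y))\<^sup>2"
    by (intro tendsto_le[OF _ lim2 lim]) auto
  then show ?thesis by simp
qed

text \<open>Expand the square, then avoid the root by
  \<open>1 - 2 * a + b \<le> (1 - a + b)\<^sup>2\<close>, whose two sides differ by
  \<open>(a - b)\<^sup>2 + b\<close>. The Lipschitz term is of second order in
  \<open>\<alpha>\<close>; \<open>\<alpha> * tc \<le> 1\<close> keeps the factor
  nonnegative.\<close>

lemma gradient_step_contraction:
  fixes G :: "'v::real_inner"
  assumes mono: "tc * (norm (x - w))\<^sup>2 \<le> G \<bullet> (x - w)" and G: "norm G \<le> L * norm (x - w)"
    and \<alpha>: "0 \<le> \<alpha>" "\<alpha> * tc \<le> 1"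
  shows "norm (x - \<alpha> *\<^sub>R G - w) \<le> (1 - \<alpha> * tc + \<alpha>\<^sup>2 * L\<^sup>2) * norm (x - w)"
proof (rule power2_le_imp_le)
  let ?r = "norm (x - w)"
  have "(norm (x - \<alpha> *\<^sub>R G - w))\<^sup>2 = (norm ((x - w) - \<alpha> *\<^sub>R G))\<^sup>2"
    by (simp add: algebra_simps)
  also have "\<dots> = ?r\<^sup>2 - 2 * \<alpha> * (G \<bullet> (x - w)) + \<alpha>\<^sup>2 * (norm G)\<^sup>2"
    unfolding power2_norm_eq_inner
    by (simp add: inner_diff_left inner_diff_right inner_commute algebra_simps power2_eq_square)
  also have "\<dots> \<le> ?r\<^sup>2 - 2 * \<alpha> * (tc * ?r\<^sup>2) + \<alpha>\<^sup>2 * (L * ?r)\<^sup>2"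
    using mono \<alpha> G by (intro add_mono diff_mono mult_left_mono power_mono) auto
  also have "\<dots> = (1 - 2 * (\<alpha> * tc) + \<alpha>\<^sup>2 * L\<^sup>2) * ?r\<^sup>2"
    by (simp add: algebra_simps power2_eq_square)
  also have "\<dots> \<le> (1 - \<alpha> * tc + \<alpha>\<^sup>2 * L\<^sup>2)\<^sup>2 * ?r\<^sup>2"
  proof (rule mult_right_mono)
    have sq: "1 - 2 * a + b \<le> (1 - a + b)\<^sup>2" if "a \<le> 1" "0 \<le> b" for a b :: real
    proof -
      have "(1 - a + b)\<^sup>2 - (1 - 2 * a + b) = (a - b)\<^sup>2 + b" by (simp add: power2_eq_square algebra_simps)
      moreover have "0 \<le> (a - b)\<^sup>2 + b" using that by simp
      ultimately show ?thesis by linarith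
    qed
    show "1 - 2 * (\<alpha> * tc) + \<alpha>\<^sup>2 * L\<^sup>2 \<le> (1 - \<alpha> * tc + \<alpha>\<^sup>2 * L\<^sup>2)\<^sup>2"
      by (rule sq) (use \<alpha> in auto)
  qed simp
  finally show "(norm (x - \<alpha> *\<^sub>R G - w))\<^sup>2 \<le> ((1 - \<alpha> * tc + \<alpha>\<^sup>2 * L\<^sup>2) * ?r)\<^sup>2"
    by (simp add: power_mult_distrib)
qed (use \<alpha> in auto)

text \<open>Small-gain argument: consensus and tracking errors (Ec, Et) are kept below a multiple of
  the step size times the geometric bound for the optimality error Eo, so their feedback into Eo
  is of second order in the step size and costs at most half of the contraction factor.\<close>
lemma small_gain:
  fixes \<eta> \<kappa> c \<gamma> a b B :: real and K N :: nat and Eo Ec Et Z :: "nat \<Rightarrow> real"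
  assumes \<eta>: "0 < \<eta>" "\<eta> < 1" and \<kappa>: "0 < \<kappa>" and c: "0 < c" and K: "0 < K"
    and a_def: "a = 4 * c\<^sup>2 * K / \<eta>" and b_def: "b = 2 * c * K * (a + 2 * c) / \<eta>"
    and \<gamma>: "0 < \<gamma>" and g1: "\<kappa> * \<gamma> < 1" and g2: "K * \<kappa> * \<gamma> < \<eta>" and g3: "\<gamma> * (a + b) < 1"
    and g4: "\<gamma> * (c * (1 + a + b)) < \<kappa> / 2"
    and B: "0 \<le> B"
    and init: "\<And>k. k \<le> K \<Longrightarrow> Eo k \<le> B * (1 - \<kappa> * \<gamma> / 2) ^ k"
      "\<And>k. k \<le> K \<Longrightarrow> Ec k \<le> \<gamma> * a * (B * (1 - \<kappa> * \<gamma> / 2) ^ k)"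
      "\<And>k. k \<le> K \<Longrightarrow> Et k \<le> \<gamma> * b * (B * (1 - \<kappa> * \<gamma> / 2) ^ k)"
    and Eo: "\<And>k. K \<le> k \<Longrightarrow> k < N \<Longrightarrow>
       Eo (Suc k) \<le> (1 - \<kappa> * \<gamma> + c * \<gamma>\<^sup>2) * Eo k + \<gamma> * c * (Ec k + Et k)"
    and Ec: "\<And>k. Ec (k + K) \<le> (1 - \<eta>) * Ec k + c * \<gamma> * (\<Sum>l<K. Z (k + l))"
    and Et: "\<And>k. Et (k + K) \<le> (1 - \<eta>) * Et k + c * (\<Sum>l<K. Ec (k + l) + \<gamma> * Z (k + l))"
    and Z: "\<And>k. k \<le> N \<Longrightarrow> Z k \<le> c * (Eo k + Ec k + Et k)"
    and kN: "k \<le> N"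
  shows "Eo k \<le> B * (1 - \<kappa> * \<gamma> / 2) ^ k" "Ec k \<le> \<gamma> * a * (B * (1 - \<kappa> * \<gamma> / 2) ^ k)"
proof -
  have a: "0 < a" using c K \<eta> by (simp add: a_def)
  have b: "0 < b" using c K \<eta> a by (simp add: b_def)
  define lam where "lam = 1 - \<kappa> * \<gamma> / 2"
  have lam: "0 < lam" "lam < 1" using g1 \<gamma> \<kappa> by (simp_all add: lam_def)
  \<comment> \<open>By Bernoulli and \<open>g2\<close>, the target rate loses at most
    \<open>\<eta> / 2\<close> over \<open>K\<close> steps, half of the contraction available to
    \<open>Ec\<close> and \<open>Et\<close>.\<close>
  have lamK: "1 - \<eta> / 2 \<le> lam ^ K"
  proof -
    have "1 - \<eta> / 2 \<le> 1 + real K * (- (\<kappa> * \<gamma> / 2))" using g2 by simp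
    also have "\<dots> \<le> (1 + (- (\<kappa> * \<gamma> / 2))) ^ K"
      by (rule Bernoulli_inequality) (use g1 in simp)
    finally show ?thesis by (simp add: lam_def)
  qed
  define R where "R k = B * lam ^ k" for k
  have R0: "0 \<le> R k" for k using B lam by (simp add: R_def)
  have Rdec: "R (k + l) \<le> R k" for k l
  proof -
    have "lam ^ (k + l) \<le> lam ^ k" using lam by (intro power_decreasing) auto
    then show ?thesis unfolding R_def using B by (rule mult_left_mono)
  qed
  have RK: "(1 - \<eta> / 2) * R k \<le> R (k + K)" for k
    using mult_right_mono[OF lamK R0[of k]] by (simp add: R_def power_add mult_ac)
  have claim: "k \<le> N \<longrightarrow> Eo k \<le> R k \<and> Ec k \<le> \<gamma> * a * R k \<and> Et k \<le> \<gamma> * b * R k" for k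
  proof (induction k rule: less_induct)
    case (less n)
    show ?case
    proof (intro impI)
      assume nN: "n \<le> N"
      show "Eo n \<le> R n \<and> Ec n \<le> \<gamma> * a * R n \<and> Et n \<le> \<gamma> * b * R n"
      proof (cases "n \<le> K")
        \<comment> \<open>The one-step recursion for \<open>Eo\<close> starts only at
          \<open>K\<close>, and the other two look back \<open>K\<close> steps; up to
          \<open>K\<close> the bounds come from \<open>init\<close>.\<close>
        case True
        then show ?thesis using init by (simp add: R_def lam_def)
      next
        case False
        have IH: "Eo m \<le> R m" "Ec m \<le> \<gamma> * a * R m" "Et m \<le> \<gamma> * b * R m" if "m < n" for m
          using less that nN by auto
        have Zm: "Z m \<le> 2 * c * R m" if "m < n" for m
        proof -
          have "Z m \<le> c * (Eo m + Ec m + Et m)" using Z that nN by auto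
          also have "\<dots> \<le> c * (R m + \<gamma> * a * R m + \<gamma> * b * R m)"
            using IH[OF that] c by (intro mult_left_mono) auto
          also have "\<dots> = c * ((1 + \<gamma> * (a + b)) * R m)" by (simp add: algebra_simps)
          also have "\<dots> \<le> c * (2 * R m)"
            using c g3 R0 by (intro mult_left_mono mult_right_mono) auto
          finally show ?thesis by simp
        qed
        obtain k where k: "n = k + K" using False by (metis add.commute le_add_diff_inverse nat_le_linear)
        have Zl: "Z (k + l) \<le> 2 * c * R k" if "l < K" for l
          using Zm[of "k + l"] that k Rdec[of k l] c
          by (smt (verit) add_less_cancel_left mult_left_mono zero_less_mult_iff)
        have "Ec n \<le> (1 - \<eta>) * Ec k + c * \<gamma> * (\<Sum>l<K. Z (k + l))" using Ec k by simp
        also have "\<dots> \<le> (1 - \<eta>) * (\<gamma> * a * R k) + c * \<gamma> * (\<Sum>l<K. 2 * c * R k)"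
          using IH[of k] k K \<eta> c \<gamma> Zl by (intro add_mono mult_left_mono sum_mono) auto
        also have "\<dots> = \<gamma> * R k * ((1 - \<eta>) * a + 2 * c\<^sup>2 * K)"
          by (simp add: algebra_simps power2_eq_square)
        \<comment> \<open>\<open>a\<close> is chosen so that the forcing
          \<open>2 * c\<^sup>2 * K\<close> equals \<open>a * \<eta> / 2\<close>, leaving the factor
          \<open>1 - \<eta> / 2\<close> that \<open>RK\<close> absorbs.\<close>
        also have "(1 - \<eta>) * a + 2 * c\<^sup>2 * K = a * (1 - \<eta> / 2)"
          using \<eta> by (simp add: a_def field_simps)
        also have "\<gamma> * R k * (a * (1 - \<eta> / 2)) = \<gamma> * a * ((1 - \<eta> / 2) * R k)" by simp
        also have "\<dots> \<le> \<gamma> * a * R n"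
          unfolding k using \<gamma> a by (intro mult_left_mono RK) auto
        finally have ec: "Ec n \<le> \<gamma> * a * R n" .
        have El: "Ec (k + l) + \<gamma> * Z (k + l) \<le> \<gamma> * (a + 2 * c) * R k" if "l < K" for l
        proof -
          have "Ec (k + l) \<le> \<gamma> * a * R (k + l)" using IH that k by simp
          also have "\<dots> \<le> \<gamma> * a * R k" using \<gamma> a by (intro mult_left_mono Rdec) auto
          finally have "Ec (k + l) \<le> \<gamma> * a * R k" .
          moreover have "\<gamma> * Z (k + l) \<le> \<gamma> * (2 * c * R k)"
            using Zl[OF that] \<gamma> by (intro mult_left_mono) auto
          ultimately show ?thesis by (simp add: algebra_simps)
        qed
        have "Et n \<le> (1 - \<eta>) * Et k + c * (\<Sum>l<K. Ec (k + l) + \<gamma> * Z (k + l))" using Et k by simp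
        also have "\<dots> \<le> (1 - \<eta>) * (\<gamma> * b * R k) + c * (\<Sum>l<K. \<gamma> * (a + 2 * c) * R k)"
          using IH[of k] k K \<eta> c El by (intro add_mono mult_left_mono sum_mono) auto
        also have "\<dots> = \<gamma> * R k * ((1 - \<eta>) * b + c * K * (a + 2 * c))"
          by (simp add: algebra_simps)
        \<comment> \<open>\<open>b\<close> balances in the same way: its forcing
          \<open>c * K * (a + 2 * c)\<close> equals \<open>b * \<eta> / 2\<close>.\<close>
        also have "(1 - \<eta>) * b + c * K * (a + 2 * c) = b * (1 - \<eta> / 2)"
          using \<eta> by (simp add: b_def field_simps)
        also have "\<gamma> * R k * (b * (1 - \<eta> / 2)) = \<gamma> * b * ((1 - \<eta> / 2) * R k)" by simp
        also have "\<dots> \<le> \<gamma> * b * R n"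
          unfolding k using \<gamma> b by (intro mult_left_mono RK) auto
        finally have et: "Et n \<le> \<gamma> * b * R n" .
        obtain m where m: "n = Suc m" using False by (cases n) auto
        have "Eo n \<le> (1 - \<kappa> * \<gamma> + c * \<gamma>\<^sup>2) * Eo m + \<gamma> * c * (Ec m + Et m)"
          using Eo m False nN by auto
        also have "\<dots> \<le> (1 - \<kappa> * \<gamma> + c * \<gamma>\<^sup>2) * R m + \<gamma> * c * (\<gamma> * a * R m + \<gamma> * b * R m)"
          using IH[of m] m g1 c \<gamma> by (intro add_mono mult_left_mono) auto
        also have "\<dots> = (1 - \<kappa> * \<gamma> + \<gamma> * (\<gamma> * (c * (1 + a + b)))) * R m"
          by (simp add: algebra_simps power2_eq_square)
        \<comment> \<open>By \<open>g4\<close> all second-order terms together use up at most half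
          of \<open>\<kappa> * \<gamma>\<close>.\<close>
        also have "\<dots> \<le> (1 - \<kappa> * \<gamma> + \<gamma> * (\<kappa> / 2)) * R m"
          using g4 \<gamma> R0 by (intro mult_right_mono add_left_mono mult_left_mono) auto
        also have "\<dots> = R n" by (simp add: m R_def lam_def algebra_simps)
        finally show ?thesis using ec et by simp
      qed
    qed
  qed
  from claim[of k] kN show "Eo k \<le> B * (1 - \<kappa> * \<gamma> / 2) ^ k" "Ec k \<le> \<gamma> * a * (B * (1 - \<kappa> * \<gamma> / 2) ^ k)"
    by (simp_all add: R_def lam_def)
qed

subsection \<open>Error recursions along a run\<close>

definition prev_tau :: "nat \<Rightarrow> (nat \<Rightarrow> 'i \<Rightarrow> 'i \<Rightarrow> int) \<Rightarrow> nat \<Rightarrow> 'i \<Rightarrow> 'i \<Rightarrow> int" where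
  "prev_tau D tau k i j = (if k = 0 then - int D else tau (k - 1) i j)"

lemma asy_sonata_tau:
  assumes "asy_sonata E W A g gam ik d D x0 x z v rho rt tau"
  shows "tau k i j = (if i = ik k \<and> (j, i) \<in> E then max (prev_tau D tau k i j) (int k - int (d k j))
     else prev_tau D tau k i j)"
  using assms unfolding asy_sonata_def prev_tau_def Let_def by blast

lemma asy_sonata_tau_le:
  assumes "asy_sonata E W A g gam ik d D x0 x z v rho rt tau"
  shows "tau k i j \<le> int k"
proof (induction k)
  case 0
  then show ?case using asy_sonata_tau[OF assms, of 0 i j] by (auto simp: prev_tau_def)
next
  case (Suc k)
  then show ?case using asy_sonata_tau[OF assms, of "Suc k" i j] by (auto simp: prev_tau_def)
qed

lemma sum_telescope_from:
  fixes r :: "nat \<Rightarrow> 'v::ab_group_add"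
  assumes "l \<le> Suc n"
  shows "(\<Sum>a\<le>n. if l \<le> a then r a - r (Suc a) else 0) = r l - r (Suc n)"
  using assms
proof (induction n)
  case 0
  then show ?case by (cases l) auto
next
  case (Suc n)
  show ?case
  proof (cases "l = Suc (Suc n)")
    case True
    then show ?thesis by (auto intro!: sum.neutral)
  next
    case False
    then show ?thesis using Suc by simp
  qed
qed

text \<open>Strong convexity enters only as strong monotonicity of the summed gradient towards
  \<open>w\<close>, and a single constant \<open>L\<close> serves all agents.\<close>

locale sonata_run =
  consensus_network E mbar ik T D tau W + tracking_network E mbar ik T D tau A
  for E :: "('i::finite \<times> 'i) set" and mbar ik T D tau W A +
  fixes g :: "'i \<Rightarrow> 'v::real_inner \<Rightarrow> 'v" and gam :: real and d x0 x z v rho rt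
    and L tc :: real and w :: 'v
  assumes run: "asy_sonata E W A g (\<lambda>_. gam) ik d D x0 x z v rho rt tau"
    and L_nonneg: "0 \<le> L" and lip: "\<And>i x y. norm (g i x - g i y) \<le> L * norm (x - y)"
    and smono: "\<And>x. tc * (norm (x - w))\<^sup>2 \<le> (\<Sum>i\<in>UNIV. g i x) \<bullet> (x - w)"
    and stationary: "(\<Sum>i\<in>UNIV. g i w) = 0"
    and gam: "0 < gam" "gam * tc \<le> 1" and tc: "0 < tc"
begin

abbreviation pt where "pt \<equiv> prev_tau D tau"

lemma init:
  "z 0 i = g i (x 0 i)" "rt 0 i j = 0"
  "- int D \<le> t \<Longrightarrow> t \<le> 0 \<Longrightarrow> rho t i j = 0"
  using run unfolding asy_sonata_def by blast+

definition zh where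
  "zh k i = z k i + (\<Sum>j | (j, i) \<in> E. rho (tau k i j) i j - rt k i j) + g i (x (Suc k) i) - g i (x k i)"

lemma update:
  "v (int (Suc k)) i = (if i = ik k then x k i - gam *\<^sub>R z k i else v (int k) i)"
  "x (Suc k) i = (if i = ik k then W i i *\<^sub>R v (int (Suc k)) i
       + (\<Sum>j | (j, i) \<in> E. W i j *\<^sub>R v (tau k i j) j) else x k i)"
  "z (Suc k) i = (if i = ik k then A i i *\<^sub>R zh k i else z k i)"
  "rho (int (Suc k)) j i = (if i = ik k \<and> (i, j) \<in> E then rho (int k) j i + A j i *\<^sub>R zh k i
     else rho (int k) j i)"
  "rt (Suc k) i j = (if i = ik k \<and> (j, i) \<in> E then rho (tau k i j) i j else rt k i j)"
  using run unfolding asy_sonata_def Let_def zh_def by blast+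

lemmas tau_rec = asy_sonata_tau[OF run]

text \<open>The buffer holds the counter at the last read index, so what an activation adds to z is
  exactly what was written on the edge since then.\<close>

lemma rt_eq: "(j, i) \<in> E \<Longrightarrow> rt k i j = rho (pt k i j) i j"
proof (induction k)
  case 0
  then show ?case using init by (simp add: prev_tau_def)
next
  case (Suc k)
  have "pt (Suc k) i j = tau k i j" by (simp add: prev_tau_def)
  then show ?case using Suc tau_rec[of k i j] by (auto simp: update(5))
qed

section \<open>The run as a perturbed consensus chain\<close>

definition h :: "nat \<Rightarrow> 'i \<times> nat \<Rightarrow> 'v" where
  "h k s = (case s of (i, 0) \<Rightarrow> x k i | (i, Suc a) \<Rightarrow> v (int k - int a) i)"

lemma h_simps [simp]: "h k (i, 0) = x k i" "h k (i, Suc a) = v (int k - int a) i"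
  by (simp_all add: h_def)

definition uc :: "nat \<Rightarrow> 'i \<times> nat \<Rightarrow> 'v" where
  "uc k s = (if s = (ik k, 0) then - gam *\<^sub>R z k (ik k) else 0)"

lemma h_step:
  assumes "s \<in> cS"
  shows "h (Suc k) s = (\<Sum>t\<in>cS. cM k s t *\<^sub>R (h k t + uc k t))"
proof -
  obtain i m where s: "s = (i, m)" "m \<le> Suc D" using assms by (auto simp: cS_def)
  consider "m = 0" | "m = Suc 0" | a where "m = Suc (Suc a)" "Suc a \<le> D"
    using s by (cases m rule: nat.exhaust; cases "m - 1") auto
  then show ?thesis
  proof cases
    case 1
    have "(\<Sum>j | (j, i) \<in> E. W i j *\<^sub>R v (int k - int (lag k i j)) j)
        = (\<Sum>j | (j, i) \<in> E. W i j *\<^sub>R v (tau k i j) j)" if "i = ik k"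
      using that of_nat_lag by (intro sum.cong) auto
    then show ?thesis unfolding s 1 cM_x_apply
      using update(1)[of k i] update(2)[of k i] by (auto simp: uc_def)
  next
    case 2
    then show ?thesis unfolding s 2 cM_v_apply using update(1)[of k i] by (simp add: uc_def)
  next
    case 3
    then show ?thesis unfolding s 3 cM_shift_apply[OF 3(2)] by (simp add: uc_def)
  qed
qed

definition Z :: "nat \<Rightarrow> real" where "Z k = norm (z k (ik k))"

sublocale PC: perturbed_row_chain cS cM mbar h uc "\<lambda>k. gam * Z k"
  using h_step gam by unfold_locales (auto simp: uc_def Z_def)

lemma node_in_cS: "(i, 0) \<in> cS"
  by (simp add: cS_def)

section \<open>The run as perturbed mass transport\<close>

text \<open>The increment of the counter written at time \<open>k - a\<close>, cut off at the read
  index so that consumed mass counts as 0; the last age collects all older unread increments. The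
  cut-off also keeps the time indices at or above -D, where \<open>rho\<close> is specified.\<close>

definition pend :: "nat \<Rightarrow> 'i \<times> 'i \<Rightarrow> nat \<Rightarrow> 'v" where
  "pend k e a = rho (max (int k - int a) (pt k (snd e) (fst e))) (snd e) (fst e)
     - (if a \<le> D then rho (max (int k - int a - 1) (pt k (snd e) (fst e))) (snd e) (fst e)
        else rho (pt k (snd e) (fst e)) (snd e) (fst e))"

fun y :: "nat \<Rightarrow> 'i + ('i \<times> 'i) \<times> nat \<Rightarrow> 'v" where
  "y k (Inl i) = z k i"
| "y k (Inr (e, a)) = pend k e a"

text \<open>The received ages are those from the lag upwards, and their increments telescope from
  the new read index down to the old one.\<close>

lemma pend_received_sum:
  assumes e: "(j, ik k) \<in> E"
  shows "(\<Sum>a\<le>Suc D. if received k (j, ik k) a then pend k (j, ik k) a else 0)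
    = rho (tau k (ik k) j) (ik k) j - rho (pt k (ik k) j) (ik k) j"
proof -
  let ?i = "ik k"
  let ?p = "pt k ?i j" and ?l = "lag k ?i j"
  define r where "r a = rho (max (int k - int a) ?p) ?i j" for a
  have rec: "received k (j, ?i) a \<longleftrightarrow> ?l \<le> a" for a
    using of_nat_lag[OF e] by (auto simp: received_def)
  have p1: "pend k (j, ?i) a = r a - r (Suc a)" if "a \<le> D" for a
    using that by (simp add: pend_def r_def algebra_simps)
  have p2: "pend k (j, ?i) (Suc D) = r (Suc D) - rho ?p ?i j"
    by (simp add: pend_def r_def)
  have "(\<Sum>a\<le>D. if received k (j, ?i) a then pend k (j, ?i) a else 0)
      = (\<Sum>a\<le>D. if ?l \<le> a then r a - r (Suc a) else 0)"
    using p1 rec by (intro sum.cong) auto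
  also have "\<dots> = r ?l - r (Suc D)" using lag_le[OF e] by (intro sum_telescope_from) simp
  finally have "(\<Sum>a\<le>Suc D. if received k (j, ?i) a then pend k (j, ?i) a else 0) = r ?l - rho ?p ?i j"
    using lag_le[OF e] rec p2 by simp
  moreover have "r ?l = rho (tau k ?i j) ?i j"
    using of_nat_lag[OF e] tau_rec[of k ?i j] e by (simp add: r_def max_absorb1)
  ultimately show ?thesis by simp
qed

lemma pend_0: "(j, i) \<in> E \<Longrightarrow> pend (Suc k) (j, i) 0 = (if j = ik k then A i j *\<^sub>R zh k j else 0)"
proof -
  assume e: "(j, i) \<in> E"
  have p: "pt (Suc k) i j = tau k i j" by (simp add: prev_tau_def)
  have "tau k i j \<le> int k" by (rule asy_sonata_tau_le[OF run])
  then have "pend (Suc k) (j, i) 0 = rho (int (Suc k)) i j - rho (int k) i j"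
    by (simp add: pend_def p max_absorb1)
  then show ?thesis using e update(4)[of k i j] by simp
qed

lemma pend_Suc:
  assumes e: "(j, i) \<in> E" and b: "b \<le> D"
  shows "(\<Sum>a\<le>Suc D. if \<not> received k (j, i) a \<and> Suc b = min (Suc a) (Suc D) then pend k (j, i) a else 0)
    = pend (Suc k) (j, i) (Suc b)"
proof -
  let ?q = "tau k i j" and ?p = "pt k i j"
  have pq: "?p \<le> ?q" using tau_rec[of k i j] by auto
  have idle: "?q = ?p" if "i \<noteq> ik k" using tau_rec[of k i j] that by simp
  have busy: "int k - int D \<le> ?q" if "i = ik k" using tau_ge e that by simp
  have p: "pt (Suc k) i j = ?q" by (simp add: prev_tau_def)
  show ?thesis
  \<comment> \<open>For \<open>b < D\<close> only age \<open>b\<close> feeds age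
    \<open>Suc b\<close>; the last age is fed by the two ages \<open>D\<close> and
    \<open>Suc D\<close>, both of which are emptied when the head is active.\<close>
  proof (cases "b < D")
    case True
    have "(\<Sum>a\<le>Suc D. if \<not> received k (j, i) a \<and> Suc b = min (Suc a) (Suc D) then pend k (j, i) a else 0)
        = (\<Sum>a\<le>Suc D. if a = b then (if received k (j, i) b then 0 else pend k (j, i) b) else 0)"
      using True by (intro sum.cong) auto
    also have "\<dots> = (if received k (j, i) b then 0 else pend k (j, i) b)"
      using True by (subst sum.delta) auto
    also have "\<dots> = rho (max (int k - int b) ?q) i j - rho (max (int k - int b - 1) ?q) i j"
    proof (cases "i = ik k")
      case i: True
      show ?thesis
      proof (cases "int k - int b \<le> ?q")
        case True
        then show ?thesis using i by (simp add: received_def max_absorb2)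
      next
        case False
        then have "\<not> received k (j, i) b" by (simp add: received_def)
        then show ?thesis using False pq True by (simp add: pend_def max_absorb1)
      qed
    next
      case False
      then show ?thesis using True idle by (simp add: received_def pend_def)
    qed
    finally show ?thesis using True by (simp add: pend_def p algebra_simps)
  next
    case False
    then have bD: "b = D" using b by simp
    have "(\<Sum>a\<le>Suc D. if \<not> received k (j, i) a \<and> Suc b = min (Suc a) (Suc D) then pend k (j, i) a else 0)
        = (\<Sum>a<D. 0) + (if received k (j, i) D then 0 else pend k (j, i) D)
          + (if received k (j, i) (Suc D) then 0 else pend k (j, i) (Suc D))"
      unfolding bD sum.atMost_Suc lessThan_Suc_atMost[symmetric] sum.lessThan_Suc
      by (intro arg_cong2[where f = "(+)"] sum.cong) auto
    also have "\<dots> = rho (max (int k - int D) ?q) i j - rho ?q i j"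
    proof (cases "i = ik k")
      case True
      then show ?thesis using busy by (simp add: received_def max_absorb2)
    next
      case False
      then show ?thesis using idle by (simp add: received_def pend_def algebra_simps)
    qed
    finally show ?thesis by (simp add: bD pend_def p algebra_simps)
  qed
qed

definition eps :: "nat \<Rightarrow> 'v" where
  "eps k = g (ik k) (x (Suc k) (ik k)) - g (ik k) (x k (ik k))"

definition ut :: "nat \<Rightarrow> 'i + ('i \<times> 'i) \<times> nat \<Rightarrow> 'v" where
  "ut k t = (if t = Inl (ik k) then eps k else 0)"

lemma y_step:
  assumes "s \<in> tS"
  shows "y (Suc k) s = (\<Sum>t\<in>tS. tM k s t *\<^sub>R (y k t + ut k t))"
proof -
  let ?i = "ik k"
  have recv: "(\<Sum>a\<le>Suc D. if received k (j, ?i) a then y k (Inr ((j, ?i), a)) + ut k (Inr ((j, ?i), a)) else 0)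
      = rho (tau k ?i j) ?i j - rt k ?i j" if "(j, ?i) \<in> E" for j
    using pend_received_sum[OF that] rt_eq[OF that, of k] by (simp add: ut_def cong: if_cong del: sum.atMost_Suc)
  \<comment> \<open>The total collected by the active agent, gradient correction included, is the
    intermediate variable of step (4).\<close>
  have z: "(y k (Inl ?i) + ut k (Inl ?i)) + (\<Sum>j | (j, ?i) \<in> E. \<Sum>a\<le>Suc D.
       if received k (j, ?i) a then y k (Inr ((j, ?i), a)) + ut k (Inr ((j, ?i), a)) else 0) = zh k ?i"
  proof -
    have "(\<Sum>j | (j, ?i) \<in> E. \<Sum>a\<le>Suc D.
       if received k (j, ?i) a then y k (Inr ((j, ?i), a)) + ut k (Inr ((j, ?i), a)) else 0)
       = (\<Sum>j | (j, ?i) \<in> E. rho (tau k ?i j) ?i j - rt k ?i j)"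
      by (intro sum.cong refl recv) simp
    then show ?thesis by (simp only: y.simps) (simp add: zh_def ut_def eps_def)
  qed
  show ?thesis unfolding tM_apply z
  proof (cases s)
    case (Inl l)
    then show "y (Suc k) s = push ?i s *\<^sub>R zh k ?i + (case s of Inl l \<Rightarrow> if l = ?i then 0 else y k (Inl l) + ut k (Inl l)
        | Inr (e, b) \<Rightarrow> if e \<in> E then \<Sum>a\<le>Suc D. if \<not> received k e a \<and> b = min (Suc a) (Suc D)
            then y k (Inr (e, a)) + ut k (Inr (e, a)) else 0 else 0)"
      by (simp add: update(3) ut_def del: sum.atMost_Suc)
  next
    case (Inr q)
    obtain j i b where q: "q = ((j, i), b)" by (metis surj_pair)
    have e: "(j, i) \<in> E" "b \<le> Suc D" using assms by (auto simp: tS_def Inr q)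
    show "y (Suc k) s = push ?i s *\<^sub>R zh k ?i + (case s of Inl l \<Rightarrow> if l = ?i then 0 else y k (Inl l) + ut k (Inl l)
        | Inr (e, b) \<Rightarrow> if e \<in> E then \<Sum>a\<le>Suc D. if \<not> received k e a \<and> b = min (Suc a) (Suc D)
            then y k (Inr (e, a)) + ut k (Inr (e, a)) else 0 else 0)"
    proof (cases b)
      case 0
      then show ?thesis using e pend_0[OF e(1), of k] by (simp add: Inr q)
    next
      case (Suc b')
      then show ?thesis using e pend_Suc[OF e(1), of b' k]
        by (simp add: Inr q ut_def cong: if_cong del: sum.atMost_Suc)
    qed
  qed
qed

definition G :: "nat \<Rightarrow> 'v" where "G k = (\<Sum>i\<in>UNIV. g i (x k i))"

lemma G_Suc: "G (Suc k) = G k + eps k"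
proof -
  have "G (Suc k) - G k = (\<Sum>i\<in>UNIV. g i (x (Suc k) i) - g i (x k i))"
    by (simp add: G_def sum_subtractf)
  also have "\<dots> = (\<Sum>i\<in>UNIV. if i = ik k then eps k else 0)"
    by (intro sum.cong) (auto simp: eps_def update(2))
  finally show ?thesis by (simp add: algebra_simps)
qed

lemma ut_sum: "(\<Sum>t\<in>tS. ut k t) = eps k"
  unfolding ut_def using finite_tS by (subst sum.delta) (auto simp: tS_def)

text \<open>The gradient-tracking invariant: z starts at the local gradients with empty edges,
  transport conserves mass, and each iteration injects exactly the change of
  \<open>G\<close>.\<close>

lemma y_sum: "(\<Sum>t\<in>tS. y k t) = G k"
proof (induction k)
  case 0
  have "pend 0 e a = 0" for e a
    by (auto simp: pend_def prev_tau_def init)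
  then show ?case by (simp add: sum_tS G_def init del: sum.atMost_Suc)
next
  case (Suc k)
  have "(\<Sum>s\<in>tS. y (Suc k) s) = (\<Sum>s\<in>tS. \<Sum>t\<in>tS. tM k s t *\<^sub>R (y k t + ut k t))"
    using y_step by simp
  also have "\<dots> = (\<Sum>t\<in>tS. (\<Sum>s\<in>tS. tM k s t) *\<^sub>R (y k t + ut k t))"
    by (subst sum.swap) (simp add: scaleR_sum_left)
  also have "\<dots> = (\<Sum>t\<in>tS. y k t + ut k t)" by (simp add: tM_column_sum)
  finally show ?case using Suc by (simp add: sum.distrib ut_sum G_Suc)
qed

text \<open>The distribution over the nodes of a unit mass released at one fixed agent. It obeys the
  unperturbed chain exactly, and the initial distribution is forgotten by contraction.\<close>

definition xi :: "nat \<Rightarrow> 'i + ('i \<times> 'i) \<times> nat \<Rightarrow> real" where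
  "xi k s = Q.P 0 k s (Inl (ik 0))"

lemma Inl_in_tS: "Inl i \<in> tS"
  by (auto simp: tS_def)

lemma xi_nonneg: "s \<in> tS \<Longrightarrow> 0 \<le> xi k s" and xi_le_1: "s \<in> tS \<Longrightarrow> xi k s \<le> 1"
  and xi_sum: "(\<Sum>s\<in>tS. xi k s) = 1"
  and xi_Suc: "xi (Suc k) s = (\<Sum>t\<in>tS. tM k s t * xi k t)"
  unfolding xi_def using Q.P_nonneg Q.P_le_1 Q.P_column_sum Inl_in_tS by auto

lemma xi_ge: "K1 \<le> k \<Longrightarrow> mbar ^ K1 \<le> xi k (Inl i)"
  unfolding xi_def by (rule Q.P_row_lower_bound[OF P_row_ge]) (auto simp: Inl_in_tS)

definition te :: "nat \<Rightarrow> 'i + ('i \<times> 'i) \<times> nat \<Rightarrow> 'v" where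
  "te k s = y k s - xi k s *\<^sub>R G k"

definition Et :: "nat \<Rightarrow> real" where "Et k = (\<Sum>s\<in>tS. norm (te k s))"

text \<open>\<open>y\<close> and \<open>xi\<close> follow the same matrices, so \<open>te\<close> is
  again a perturbed chain. Its injection is \<open>eps\<close> at the active agent minus
  \<open>eps\<close> spread out by \<open>xi\<close>, hence the factor 2.\<close>

sublocale PT: perturbed_column_chain tS tM mbar te "\<lambda>k t. ut k t - xi k t *\<^sub>R eps k" "\<lambda>k. 2 * norm (eps k)"
proof unfold_locales
  fix k s assume "s \<in> tS"
  have "tM k s t *\<^sub>R (te k t + (ut k t - xi k t *\<^sub>R eps k))
      = tM k s t *\<^sub>R (y k t + ut k t) - (tM k s t * xi k t) *\<^sub>R (G k + eps k)" for t
    by (simp add: te_def scaleR_add_right scaleR_diff_right)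
  then show "te (Suc k) s = (\<Sum>t\<in>tS. tM k s t *\<^sub>R (te k t + (ut k t - xi k t *\<^sub>R eps k)))"
    unfolding te_def[of "Suc k"] y_step[OF \<open>s \<in> tS\<close>] xi_Suc G_Suc
    by (simp only: sum_subtractf scaleR_sum_left)
next
  fix k
  have "(\<Sum>t\<in>tS. norm (ut k t - xi k t *\<^sub>R eps k)) \<le> (\<Sum>t\<in>tS. norm (ut k t) + xi k t * norm (eps k))"
    using xi_nonneg by (intro sum_mono order_trans[OF norm_triangle_ineq4]) auto
  also have "\<dots> = (\<Sum>t\<in>tS. norm (ut k t)) + norm (eps k)"
    by (simp add: sum.distrib sum_distrib_right[symmetric] xi_sum)
  also have "(\<Sum>t\<in>tS. norm (ut k t)) = (\<Sum>t\<in>tS. if t = Inl (ik k) then norm (eps k) else 0)"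
    by (intro sum.cong) (auto simp: ut_def)
  also have "\<dots> = norm (eps k)" using finite_tS Inl_in_tS by simp
  finally show "(\<Sum>t\<in>tS. norm (ut k t - xi k t *\<^sub>R eps k)) \<le> 2 * norm (eps k)" by simp
qed

lemma te_sum: "(\<Sum>t\<in>tS. te k t) = 0"
  by (simp add: te_def sum_subtractf y_sum scaleR_sum_left[symmetric] xi_sum)

section \<open>Bounds coupling the consensus, tracking and optimality errors\<close>

definition Lam :: real where "Lam = real CARD('i) * L"

lemma L_le_Lam: "L \<le> Lam"
proof -
  have "1 * L \<le> real CARD('i) * L"
    using L_nonneg by (intro mult_right_mono) (simp_all add: Suc_le_eq)
  then show ?thesis by (simp add: Lam_def)
qed

lemma gradient_sum_diff_le:
  assumes "\<And>i. norm (p i - q i) \<le> B"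
  shows "norm ((\<Sum>i\<in>UNIV. g i (p i)) - (\<Sum>i\<in>UNIV. g i (q i))) \<le> Lam * B"
proof -
  have "norm (\<Sum>i\<in>UNIV. g i (p i) - g i (q i)) \<le> (\<Sum>i\<in>(UNIV::'i set). L * B)"
    using lip assms L_nonneg by (intro sum_norm_le) (meson mult_left_mono order_trans)
  then show ?thesis by (simp add: sum_subtractf Lam_def)
qed

text \<open>The new x is a convex combination of perturbed node values, so it moves by at most the
  spread plus the length of the gradient step.\<close>

lemma eps_le: "norm (eps k) \<le> L * (PC.spread k + gam * Z k)"
proof -
  let ?i = "ik k"
  have "norm (h (Suc k) (?i, 0) - h k (?i, 0)) \<le> PC.spread k + gam * Z k"
    unfolding h_step[OF node_in_cS]
  proof (rule norm_convex_combination_diff_le)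
    fix t assume t: "t \<in> cS"
    have "norm (h k t + uc k t - h k (?i, 0)) \<le> norm (h k t - h k (?i, 0)) + norm (uc k t)"
      using norm_triangle_ineq[of "h k t - h k (?i, 0)" "uc k t"] by (simp add: algebra_simps)
    then show "norm (h k t + uc k t - h k (?i, 0)) \<le> PC.spread k + gam * Z k"
      using PC.spread_ge[OF t node_in_cS, of k ?i] PC.u_le[OF t, of k] by linarith
  qed (use cM_nonneg cM_row_sum node_in_cS in \<open>auto simp: cS_def\<close>)
  then have "L * norm (x (Suc k) ?i - x k ?i) \<le> L * (PC.spread k + gam * Z k)"
    using L_nonneg by (intro mult_left_mono) auto
  then show ?thesis unfolding eps_def using lip order_trans by blast
qed

lemma spread_recursion:
  "PC.spread (k + K1) \<le> (1 - mbar ^ K1) * PC.spread k + 2 * gam * (\<Sum>l<K1. Z (k + l))"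
  using PC.spread_contraction[where k = k, OF node_in_cS[of "ik 0"] P_column_ge]
  by (simp add: sum_distrib_left[symmetric] mult.assoc)

lemma Et_recursion:
  "Et (k + K1) \<le> (1 - mbar ^ K1) * Et k + 2 * L * (\<Sum>l<K1. PC.spread (k + l) + gam * Z (k + l))"
proof -
  have "Et (k + K1) \<le> (1 - mbar ^ K1) * Et k + (\<Sum>l<K1. 2 * norm (eps (k + l)))"
    unfolding Et_def using PT.l1_contraction[OF Inl_in_tS P_row_ge te_sum] by blast
  also have "(\<Sum>l<K1. 2 * norm (eps (k + l))) \<le> (\<Sum>l<K1. 2 * (L * (PC.spread (k + l) + gam * Z (k + l))))"
    by (intro sum_mono mult_left_mono eps_le) auto
  finally show ?thesis by (simp add: sum_distrib_left mult.assoc)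
qed

abbreviation fc where "fc N k \<equiv> PC.forecast N (ik 0, 0) k"

definition Eo :: "nat \<Rightarrow> nat \<Rightarrow> real" where "Eo N k = norm (fc N k - w)"

lemma x_forecast_le: "norm (x k i - fc N k) \<le> PC.spread k"
  using PC.norm_forecast_diff_le[where k = k and N = N, OF node_in_cS[of "ik 0"] PC.spread_ge[OF _ node_in_cS[of i]]]
  by (simp add: norm_minus_commute)

lemma x_w_le: "norm (x k i - w) \<le> Eo N k + PC.spread k"
  unfolding Eo_def using x_forecast_le[of k i N] norm_triangle_ineq[of "x k i - fc N k" "fc N k - w"] by simp

lemma z_error: "norm (z k i - xi k (Inl i) *\<^sub>R G k) \<le> Et k"
proof -
  have "norm (te k (Inl i)) \<le> Et k"
    unfolding Et_def using Inl_in_tS finite_tS by (intro member_le_sum) auto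
  then show ?thesis by (simp add: te_def)
qed

text \<open>z is a share of \<open>G\<close> up to the tracking error, and the summed gradient
  vanishes when all agents sit at \<open>w\<close>.\<close>

lemma Z_le: "Z k \<le> Et k + Lam * (Eo N k + PC.spread k)"
proof -
  have "norm (G k - (\<Sum>i\<in>UNIV. g i w)) \<le> Lam * (Eo N k + PC.spread k)"
    unfolding G_def by (rule gradient_sum_diff_le) (rule x_w_le)
  then have "norm (G k) \<le> Lam * (Eo N k + PC.spread k)" by (simp add: stationary)
  moreover have "norm (xi k (Inl (ik k)) *\<^sub>R G k) \<le> norm (G k)"
    using xi_nonneg[OF Inl_in_tS] xi_le_1[OF Inl_in_tS] by (simp add: mult_left_le_one_le)
  ultimately show ?thesis
    unfolding Z_def using z_error[of k "ik k"] norm_triangle_sub[of "z k (ik k)" "xi k (Inl (ik k)) *\<^sub>R G k"]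
    by linarith
qed

text \<open>The forecast moves by a gradient step of effective size
  \<open>gam * \<psi> * \<xi>\<close>, where \<open>\<psi>\<close> is the forecast weight of the
  active agent and \<open>\<xi>\<close> its tracking share. \<open>K1 \<le> k\<close> secures
  \<open>\<xi> \<ge> mbar ^ K1\<close>, and the distance to the horizon secures the same for
  \<open>\<psi>\<close>.\<close>

lemma Eo_recursion:
  assumes k: "K1 \<le> k" and N: "k + K1 < N"
  shows "Eo N (Suc k) \<le> (1 - tc * (mbar ^ K1)\<^sup>2 * gam + Lam\<^sup>2 * gam\<^sup>2) * Eo N k
     + gam * (Et k + Lam * PC.spread k)"
proof -
  let ?i = "ik k" and ?\<eta> = "mbar ^ K1"
  define \<psi> where "\<psi> = C.P k (N - k) (ik 0, 0) (?i, 0)"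
  define \<xi> where "\<xi> = xi k (Inl ?i)"
  define gF where "gF = (\<Sum>i\<in>UNIV. g i (fc N k))"
  define \<alpha> where "\<alpha> = gam * (\<psi> * \<xi>)"
  have \<eta>0: "0 < ?\<eta>" using mbar by simp
  have \<psi>: "?\<eta> \<le> \<psi>" "\<psi> \<le> 1" unfolding \<psi>_def
    using N by (auto intro!: C.P_column_lower_bound[OF P_column_ge] C.P_le_1 node_in_cS)
  have \<xi>: "?\<eta> \<le> \<xi>" "\<xi> \<le> 1" unfolding \<xi>_def using k xi_ge xi_le_1[OF Inl_in_tS] by auto
  have "?\<eta>\<^sup>2 \<le> \<psi> * \<xi>" unfolding power2_eq_square using \<psi> \<xi> \<eta>0 by (intro mult_mono) auto
  then have \<alpha>1: "gam * ?\<eta>\<^sup>2 \<le> \<alpha>" unfolding \<alpha>_def using gam by (intro mult_left_mono) auto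
  have "\<psi> * \<xi> \<le> 1" using \<psi> \<xi> \<eta>0 by (intro mult_le_one) auto
  then have \<alpha>2: "\<alpha> \<le> gam" unfolding \<alpha>_def using gam by (simp add: mult_left_le)
  have \<alpha>0: "0 \<le> \<alpha>" using \<alpha>1 gam \<eta>0 by (meson less_imp_le mult_nonneg_nonneg order_trans zero_le_power2)
  have "\<alpha> * tc \<le> gam * tc" using \<alpha>2 tc by (intro mult_right_mono) auto
  then have \<alpha>3: "\<alpha> * tc \<le> 1" using gam by linarith
  have "(\<Sum>t\<in>cS. C.P k (N - k) (ik 0, 0) t *\<^sub>R uc k t)
      = (\<Sum>t\<in>cS. if t = (?i, 0) then \<psi> *\<^sub>R (- gam *\<^sub>R z k ?i) else 0)"
    by (intro sum.cong) (auto simp: uc_def \<psi>_def)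
  also have "\<dots> = - (gam * \<psi>) *\<^sub>R z k ?i"
    using C.finS node_in_cS by (simp add: mult.commute)
  finally have step: "fc N (Suc k) = fc N k - (gam * \<psi>) *\<^sub>R z k ?i"
    using PC.forecast_step[of k N "(ik 0, 0)"] N node_in_cS by simp
  \<comment> \<open>Exact gradient step at the forecast, minus the tracking error, minus the error
    from evaluating the gradients at the agents instead of the forecast.\<close>
  have eq: "fc N (Suc k) - w = (fc N k - \<alpha> *\<^sub>R gF - w) - (gam * \<psi>) *\<^sub>R (z k ?i - \<xi> *\<^sub>R G k) - \<alpha> *\<^sub>R (G k - gF)"
    unfolding step \<alpha>_def by (simp add: algebra_simps)
  have "norm (gF - (\<Sum>i\<in>UNIV. g i w)) \<le> Lam * norm (fc N k - w)"
    unfolding gF_def by (rule gradient_sum_diff_le) simp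
  then have gF: "norm gF \<le> Lam * norm (fc N k - w)" by (simp add: stationary)
  have "norm (fc N k - \<alpha> *\<^sub>R gF - w) \<le> (1 - \<alpha> * tc + \<alpha>\<^sup>2 * Lam\<^sup>2) * Eo N k"
    unfolding Eo_def using smono gF \<alpha>0 \<alpha>3 unfolding gF_def by (intro gradient_step_contraction) auto
  also have "\<dots> \<le> (1 - tc * ?\<eta>\<^sup>2 * gam + Lam\<^sup>2 * gam\<^sup>2) * Eo N k"
  proof (rule mult_right_mono)
    have "gam * ?\<eta>\<^sup>2 * tc \<le> \<alpha> * tc" using \<alpha>1 tc by (intro mult_right_mono) auto
    moreover have "\<alpha>\<^sup>2 * Lam\<^sup>2 \<le> gam\<^sup>2 * Lam\<^sup>2"
      using \<alpha>0 \<alpha>2 by (intro mult_right_mono power_mono) auto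
    ultimately show "1 - \<alpha> * tc + \<alpha>\<^sup>2 * Lam\<^sup>2 \<le> 1 - tc * ?\<eta>\<^sup>2 * gam + Lam\<^sup>2 * gam\<^sup>2"
      by (simp add: mult_ac)
  qed (simp add: Eo_def)
  finally have 1: "norm (fc N k - \<alpha> *\<^sub>R gF - w) \<le> (1 - tc * ?\<eta>\<^sup>2 * gam + Lam\<^sup>2 * gam\<^sup>2) * Eo N k" .
  have "norm ((gam * \<psi>) *\<^sub>R (z k ?i - \<xi> *\<^sub>R G k)) = gam * \<psi> * norm (z k ?i - \<xi> *\<^sub>R G k)"
    using gam \<psi> \<eta>0 by simp
  also have "\<dots> \<le> gam * 1 * Et k"
    using gam \<psi> \<eta>0 z_error[of k ?i] unfolding \<xi>_def by (intro mult_mono) auto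
  finally have 2: "norm ((gam * \<psi>) *\<^sub>R (z k ?i - \<xi> *\<^sub>R G k)) \<le> gam * Et k" by simp
  have GgF: "norm (G k - gF) \<le> Lam * PC.spread k"
    unfolding G_def gF_def by (rule gradient_sum_diff_le) (rule x_forecast_le)
  have "norm (\<alpha> *\<^sub>R (G k - gF)) = \<alpha> * norm (G k - gF)" using \<alpha>0 by simp
  also have "\<dots> \<le> gam * (Lam * PC.spread k)"
    using \<alpha>0 \<alpha>2 GgF gam by (intro mult_mono) auto
  finally have 3: "norm (\<alpha> *\<^sub>R (G k - gF)) \<le> gam * (Lam * PC.spread k)" .
  have "Eo N (Suc k) \<le> norm (fc N k - \<alpha> *\<^sub>R gF - w) + norm ((gam * \<psi>) *\<^sub>R (z k ?i - \<xi> *\<^sub>R G k))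
      + norm (\<alpha> *\<^sub>R (G k - gF))"
    unfolding Eo_def eq by (smt (verit) norm_triangle_ineq4)
  then show ?thesis using 1 2 3 by (simp add: distrib_left)
qed

lemma Eo_le_initial:
  "Eo N k \<le> (\<Sum>t\<in>cS. norm (h k t - w))"
  unfolding Eo_def
  by (rule PC.norm_forecast_diff_le[OF node_in_cS]) (use C.finS in \<open>auto intro: member_le_sum\<close>)

end

subsection \<open>Linear convergence\<close>

theorem theorem2:
  fixes f :: "'i::finite \<Rightarrow> real^'n \<Rightarrow> real"
    and g :: "'i \<Rightarrow> real^'n \<Rightarrow> real^'n"
    and L :: "'i \<Rightarrow> real"
    and tc :: real
    and xstar :: "real^'n"
    and E :: "('i \<times> 'i) set"
    and W A :: "'i \<Rightarrow> 'i \<Rightarrow> real"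
    and mbar :: real
    and ik :: "nat \<Rightarrow> 'i"
    and d :: "nat \<Rightarrow> 'i \<Rightarrow> nat"
    and T D :: nat
    and x0 :: "'i \<Rightarrow> real^'n"
  assumes grad: "\<forall>i x. (f i has_derivative (\<lambda>h. g i x \<bullet> h)) (at x)"
    and lip: "\<forall>i x y. norm (g i x - g i y) \<le> L i * norm (x - y)"
    and tc_pos: "tc > 0"
    and sconv: "strongly_convex tc (\<lambda>x. \<Sum>i\<in>UNIV. f i x)"
    and xstar_min: "\<forall>y. (\<Sum>i\<in>UNIV. f i xstar) \<le> (\<Sum>i\<in>UNIV. f i y)"
    and no_loops: "\<forall>i. (i, i) \<notin> E"
    and strongly_conn: "\<forall>i j. (i, j) \<in> E\<^sup>*"
    and mbar: "0 < mbar" "mbar < 1"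
    and W_row: "\<forall>i. (\<Sum>j\<in>UNIV. W i j) = 1" and W_pat: "weight_pattern E mbar W"
    and A_col: "\<forall>j. (\<Sum>i\<in>UNIV. A i j) = 1" and A_pat: "weight_pattern E mbar A"
    and act: "\<forall>k i. \<exists>t. k \<le> t \<and> t < k + T \<and> ik t = i"
    and delay: "\<forall>k j. (j, ik k) \<in> E \<longrightarrow> d k j \<le> D"
  shows "\<exists>gbar. gbar > 0 \<and>
           (\<forall>gam. 0 < gam \<and> gam < gbar \<longrightarrow>
              (\<exists>lam. 0 < lam \<and> lam < 1 \<and>
                 (\<forall>x z v rho rt tau. asy_sonata E W A g (\<lambda>_. gam) ik d D x0 x z v rho rt tau \<longrightarrow>
                    (\<lambda>k. norm (\<chi> i. x k i - xstar)) \<in> O(\<lambda>k. lam ^ k)))) \<and>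
           (\<exists>ghat. 0 < ghat \<and> ghat < gbar \<and>
              (\<forall>gam. 0 < gam \<and> gam \<le> ghat \<longrightarrow>
                 (\<forall>x z v rho rt tau. asy_sonata E W A g (\<lambda>_. gam) ik d D x0 x z v rho rt tau \<longrightarrow>
                    (\<lambda>k. norm (\<chi> i. x k i - xstar))
                      \<in> O(\<lambda>k. (1 - tc * (mbar ^ ((2 * CARD('i) - 1) * T + CARD('i) * D))\<^sup>2 * gam / 2) ^ k))))"
proof -
  define K where "K = (2 * CARD('i) - 1) * T + CARD('i) * D"
  define \<eta> where "\<eta> = mbar ^ K"
  define \<kappa> where "\<kappa> = tc * \<eta>\<^sup>2"
  \<comment> \<open>One Lipschitz constant for all agents, nonnegative by construction.\<close>
  define Lc where "Lc = (\<Sum>i\<in>UNIV. \<bar>L i\<bar>)"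
  define \<Lambda> where "\<Lambda> = real CARD('i) * Lc"
  \<comment> \<open>Large enough to dominate every coefficient of the recursions: 1, 2,
    \<open>2 * Lc\<close>, \<open>\<Lambda>\<close> and \<open>\<Lambda>\<^sup>2\<close>.\<close>
  define c where "c = 2 + 2 * \<Lambda> + \<Lambda>\<^sup>2"
  define gF where "gF x = (\<Sum>i\<in>UNIV. g i x)" for x
  have Lc0: "0 \<le> Lc" by (simp add: Lc_def sum_nonneg)
  have \<Lambda>0: "0 \<le> \<Lambda>" using Lc0 by (simp add: \<Lambda>_def)
  have Lip: "norm (g i x - g i y) \<le> Lc * norm (x - y)" for i x y
  proof -
    have "L i \<le> Lc" unfolding Lc_def
      using member_le_sum[of i UNIV "\<lambda>i. \<bar>L i\<bar>"] by auto
    then show ?thesis using lip by (meson mult_right_mono norm_ge_zero order_trans)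
  qed
  have derF: "((\<lambda>x. \<Sum>i\<in>UNIV. f i x) has_derivative (\<lambda>h. gF x \<bullet> h)) (at x)" for x
    unfolding gF_def inner_sum_left using grad by (intro has_derivative_sum) auto
  have "(\<lambda>h. gF xstar \<bullet> h) = (\<lambda>h. 0)"
    using xstar_min by (intro differential_zero_maxmin[OF UNIV_I open_UNIV derF]) auto
  then have "gF xstar \<bullet> gF xstar = 0" by metis
  then have gF0: "gF xstar = 0" by simp
  \<comment> \<open>Add the strong convexity inequalities based at \<open>x\<close> and at
    \<open>xstar\<close>; the function values cancel and the gradient at \<open>xstar\<close> is
    0.\<close>
  have smono: "tc * (norm (x - xstar))\<^sup>2 \<le> gF x \<bullet> (x - xstar)" for x
    using strongly_convex_gradient_ge[OF sconv derF[of x], of xstar]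
      strongly_convex_gradient_ge[OF sconv derF[of xstar], of x]
    by (simp add: gF0 norm_minus_commute inner_diff_right)
  \<comment> \<open>An activation window contains an index, so T is positive; this gives
    \<open>K > 0\<close> and thus \<open>\<eta> < 1\<close>.\<close>
  have "0 < T" using act by (metis add_0_right gr0I leD)
  moreover have "0 < CARD('i)" by simp
  then have "0 < 2 * CARD('i) - 1" by linarith
  ultimately have K: "0 < K" unfolding K_def by (intro add_pos_nonneg mult_pos_pos) auto
  have \<eta>: "0 < \<eta>" "\<eta> < 1" using mbar K by (auto simp: \<eta>_def power_less_one_iff)
  have \<kappa>: "0 < \<kappa>" using tc_pos \<eta> by (simp add: \<kappa>_def)
  have c: "0 < c" "2 \<le> c" "1 \<le> c" "2 * \<Lambda> \<le> c" "\<Lambda> \<le> c" "\<Lambda>\<^sup>2 \<le> c" using \<Lambda>0 zero_le_power2[of \<Lambda>] unfolding c_def by linarith+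
  define a where "a = 4 * c\<^sup>2 * K / \<eta>"
  define b where "b = 2 * c * K * (a + 2 * c) / \<eta>"
  have a: "0 < a" using c \<eta> K by (simp add: a_def)
  have b: "0 < b" using c \<eta> K a by (simp add: b_def)
  \<comment> \<open>One entry of the minimum for each of the smallness conditions \<open>g0\<close>
    to \<open>g4\<close>.\<close>
  define gbar where "gbar = min (1 / tc)
    (min (min (1 / \<kappa>) (\<eta> / (K * \<kappa>))) (min (1 / (a + b)) (\<kappa> / 2 / (c * (1 + a + b)))))"
  have gbar: "0 < gbar" using tc_pos \<kappa> \<eta> K a b c by (simp add: gbar_def)
  have g0: "\<gamma> * tc < 1" and g1: "\<kappa> * \<gamma> < 1" and g2: "K * \<kappa> * \<gamma> < \<eta>" and g3: "\<gamma> * (a + b) < 1"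
    and g4: "\<gamma> * (c * (1 + a + b)) < \<kappa> / 2" if "\<gamma> < gbar" for \<gamma>
  proof -
    have "\<gamma> < 1 / tc" "\<gamma> < 1 / \<kappa>" "\<gamma> < \<eta> / (K * \<kappa>)" "\<gamma> < 1 / (a + b)" "\<gamma> < \<kappa> / 2 / (c * (1 + a + b))"
      using that by (simp_all add: gbar_def)
    moreover have "0 < K * \<kappa>" "0 < a + b" "0 < c * (1 + a + b)" using K \<kappa> a b c by simp_all
    ultimately show "\<gamma> * tc < 1" "\<kappa> * \<gamma> < 1" "K * \<kappa> * \<gamma> < \<eta>" "\<gamma> * (a + b) < 1"
      "\<gamma> * (c * (1 + a + b)) < \<kappa> / 2"
      using tc_pos \<kappa> by (simp_all only: pos_less_divide_eq mult_ac)
  qed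
  have lam: "0 < 1 - \<kappa> * \<gamma> / 2" "1 - \<kappa> * \<gamma> / 2 < 1" if "0 < \<gamma>" "\<gamma> < gbar" for \<gamma>
    using g1[OF that(2)] that \<kappa> by auto
  have rate: "(\<lambda>k. norm (\<chi> i. x k i - xstar)) \<in> O(\<lambda>k. (1 - \<kappa> * gam / 2) ^ k)"
    if gam: "0 < gam" "gam < gbar" and run: "asy_sonata E W A g (\<lambda>_. gam) ik d D x0 x z v rho rt tau"
    for gam x z v rho rt tau
  proof -
    have gtc: "gam * tc \<le> 1" using g0[OF gam(2)] by simp
    interpret R: sonata_run E mbar ik T D tau W A g gam d x0 x z v rho rt Lc tc xstar
    proof unfold_locales
      fix k j assume e: "(j, ik k) \<in> E"
      have "d k j \<le> D" using delay e by blast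
      then show "int k - int D \<le> tau k (ik k) j"
        using asy_sonata_tau[OF run, of k "ik k" j] e by simp
      show "tau k (ik k) j \<le> int k" by (rule asy_sonata_tau_le[OF run])
    qed (use no_loops strongly_conn mbar act W_row W_pat A_col A_pat run Lc0 Lip smono gF0 gam gtc tc_pos
      in \<open>auto simp: gF_def\<close>)
    have RK: "R.K1 = K" by (simp add: R.K1_def K_def)
    have RL: "R.Lam = \<Lambda>" by (simp add: R.Lam_def \<Lambda>_def)
    let ?lam = "1 - \<kappa> * gam / 2"
    let ?Ec = "R.PC.spread"
    have Ec0: "0 \<le> ?Ec k" for k
      using R.PC.spread_ge[OF R.node_in_cS R.node_in_cS, of k "ik 0" "ik 0"] by simp
    have Et0: "0 \<le> R.Et k" for k by (simp add: R.Et_def sum_nonneg)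
    have Z0: "0 \<le> R.Z k" for k by (simp add: R.Z_def)
    have Eo0: "0 \<le> R.Eo N k" for N k by (simp add: R.Eo_def)
    \<comment> \<open>The three errors in the units of the small-gain bounds. Summing the normalised
      values up to \<open>K\<close> gives a \<open>B\<close> that meets all initial conditions; it
      is free of N, since the initial bound on the optimality error is.\<close>
    define X where "X k = (\<Sum>t\<in>R.cS. norm (R.h k t - xstar)) + ?Ec k / (gam * a) + R.Et k / (gam * b)" for k
    define B where "B = (\<Sum>k\<le>K. X k / ?lam ^ k)"
    have X0: "0 \<le> X k" for k
      unfolding X_def using gam a b Ec0 Et0 by (intro add_nonneg_nonneg sum_nonneg divide_nonneg_nonneg) auto
    have B0: "0 \<le> B" unfolding B_def using X0 lam[OF gam] by (intro sum_nonneg) auto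
    have XB: "X k \<le> B * ?lam ^ k" if "k \<le> K" for k
    proof -
      have "X k / ?lam ^ k \<le> B"
        unfolding B_def using X0 lam[OF gam] that by (intro member_le_sum) auto
      then show ?thesis using lam[OF gam] by (subst (asm) pos_divide_le_eq) auto
    qed
    have init: "R.Eo N k \<le> B * ?lam ^ k" "?Ec k \<le> gam * a * (B * ?lam ^ k)"
      "R.Et k \<le> gam * b * (B * ?lam ^ k)" if "k \<le> K" for k N
    proof -
      have nn: "0 \<le> (\<Sum>t\<in>R.cS. norm (R.h k t - xstar))" "0 \<le> ?Ec k / (gam * a)" "0 \<le> R.Et k / (gam * b)"
        using gam a b Ec0 Et0 by (auto intro: sum_nonneg)
      show "R.Eo N k \<le> B * ?lam ^ k"
        using R.Eo_le_initial[of N k] nn XB[OF that] by (simp add: X_def)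
      have "?Ec k / (gam * a) \<le> B * ?lam ^ k" "R.Et k / (gam * b) \<le> B * ?lam ^ k"
        using nn XB[OF that] by (simp_all add: X_def)
      then show "?Ec k \<le> gam * a * (B * ?lam ^ k)" "R.Et k \<le> gam * b * (B * ?lam ^ k)"
        using gam a b by (simp_all add: pos_divide_le_eq mult_ac)
    qed
    have E_o: "R.Eo (n + K + 1) (Suc k)
        \<le> (1 - \<kappa> * gam + c * gam\<^sup>2) * R.Eo (n + K + 1) k + gam * c * (?Ec k + R.Et k)"
      if "K \<le> k" "k < n" for n k
    proof -
      have "R.Eo (n + K + 1) (Suc k) \<le> (1 - tc * \<eta>\<^sup>2 * gam + \<Lambda>\<^sup>2 * gam\<^sup>2) * R.Eo (n + K + 1) k
          + gam * (R.Et k + \<Lambda> * ?Ec k)"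
        using R.Eo_recursion[of k "n + K + 1"] that by (simp add: RK RL \<eta>_def)
      also have "\<dots> \<le> (1 - \<kappa> * gam + c * gam\<^sup>2) * R.Eo (n + K + 1) k + gam * (c * R.Et k + c * ?Ec k)"
        using c gam Eo0 Ec0 Et0 mult_right_mono[OF c(3) Et0[of k]] unfolding \<kappa>_def
        by (intro add_mono mult_right_mono mult_left_mono diff_mono) auto
      finally show ?thesis by (simp add: algebra_simps)
    qed
    have E_c: "?Ec (k + K) \<le> (1 - \<eta>) * ?Ec k + c * gam * (\<Sum>l<K. R.Z (k + l))" for k
    proof -
      have "2 * gam * (\<Sum>l<K. R.Z (k + l)) \<le> c * gam * (\<Sum>l<K. R.Z (k + l))"
        using c gam Z0 by (intro mult_right_mono sum_nonneg) auto
      then show ?thesis using R.spread_recursion[of k] by (simp add: RK \<eta>_def)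
    qed
    have E_t: "R.Et (k + K) \<le> (1 - \<eta>) * R.Et k + c * (\<Sum>l<K. ?Ec (k + l) + gam * R.Z (k + l))" for k
    proof -
      have "2 * Lc * (\<Sum>l<K. ?Ec (k + l) + gam * R.Z (k + l)) \<le> c * (\<Sum>l<K. ?Ec (k + l) + gam * R.Z (k + l))"
        using c R.L_le_Lam RL gam Z0 Ec0 by (intro mult_right_mono sum_nonneg) auto
      then show ?thesis using R.Et_recursion[of k] by (simp add: RK \<eta>_def)
    qed
    have Z: "R.Z k \<le> c * (R.Eo N k + ?Ec k + R.Et k)" for N k
    proof -
      have "R.Z k \<le> R.Et k + \<Lambda> * (R.Eo N k + ?Ec k)" using R.Z_le[of k N] by (simp add: RL)
      also have "\<dots> \<le> c * R.Et k + c * (R.Eo N k + ?Ec k)"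
        using c Eo0[of N k] Ec0[of k] mult_right_mono[OF c(3) Et0[of k]]
        by (intro add_mono mult_right_mono) auto
      finally show ?thesis by (simp add: algebra_simps)
    qed
    \<comment> \<open>For each \<open>n\<close> the small-gain lemma is applied afresh with horizon
      \<open>n + K + 1\<close>, which stays more than \<open>K\<close> steps ahead of every
      \<open>k < n\<close>; neither \<open>B\<close> nor the rate depends on that choice.\<close>
    have bound: "norm (x n i - xstar) \<le> (1 + gam * a) * B * ?lam ^ n" for n i
    proof -
      have "R.Eo (n + K + 1) n \<le> B * ?lam ^ n" "?Ec n \<le> gam * a * (B * ?lam ^ n)"
        using small_gain[where N = n and k = n and Eo = "R.Eo (n + K + 1)", OF \<eta> \<kappa> c(1) K a_def b_def
          gam(1) g1[OF gam(2)] g2[OF gam(2)] g3[OF gam(2)] g4[OF gam(2)] B0 init E_o E_c E_t Z] by auto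
      then show ?thesis using R.x_w_le[of n i "n + K + 1"] by (simp add: algebra_simps)
    qed
    have "norm (\<chi> i. x n i - xstar) \<le> (real CARD('i) * ((1 + gam * a) * B)) * norm (?lam ^ n)" for n
    proof -
      have "norm (\<chi> i. x n i - xstar) \<le> (\<Sum>i\<in>UNIV. norm (x n i - xstar))"
        unfolding norm_vec_def by (simp add: L2_set_le_sum L2_set_nonneg)
      also have "\<dots> \<le> (\<Sum>i\<in>(UNIV::'i set). (1 + gam * a) * B * ?lam ^ n)"
        by (intro sum_mono bound)
      finally show ?thesis using lam[OF gam] by (simp add: mult_ac)
    qed
    then show ?thesis by (intro bigoI[where c = "real CARD('i) * ((1 + gam * a) * B)"] always_eventually) simp
  qed
  have target: "1 - tc * (mbar ^ ((2 * CARD('i) - 1) * T + CARD('i) * D))\<^sup>2 * gam / 2 = 1 - \<kappa> * gam / 2" for gam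
    by (simp add: \<kappa>_def \<eta>_def K_def)
  show ?thesis unfolding target
  proof (rule exI[of _ gbar], rule conjI[OF gbar], rule conjI)
    show "\<forall>gam. 0 < gam \<and> gam < gbar \<longrightarrow> (\<exists>lam. 0 < lam \<and> lam < 1 \<and>
      (\<forall>x z v rho rt tau. asy_sonata E W A g (\<lambda>_. gam) ik d D x0 x z v rho rt tau \<longrightarrow>
        (\<lambda>k. norm (\<chi> i. x k i - xstar)) \<in> O(\<lambda>k. lam ^ k)))"
    proof (intro allI impI)
      fix gam assume "0 < gam \<and> gam < gbar"
      then have gam: "0 < gam" "gam < gbar" by auto
      show "\<exists>lam. 0 < lam \<and> lam < 1 \<and>
        (\<forall>x z v rho rt tau. asy_sonata E W A g (\<lambda>_. gam) ik d D x0 x z v rho rt tau \<longrightarrow>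
          (\<lambda>k. norm (\<chi> i. x k i - xstar)) \<in> O(\<lambda>k. lam ^ k))"
        by (rule exI[of _ "1 - \<kappa> * gam / 2"], intro conjI allI impI lam[OF gam] rate[OF gam])
    qed
    show "\<exists>ghat. 0 < ghat \<and> ghat < gbar \<and> (\<forall>gam. 0 < gam \<and> gam \<le> ghat \<longrightarrow>
      (\<forall>x z v rho rt tau. asy_sonata E W A g (\<lambda>_. gam) ik d D x0 x z v rho rt tau \<longrightarrow>
        (\<lambda>k. norm (\<chi> i. x k i - xstar)) \<in> O(\<lambda>k. (1 - \<kappa> * gam / 2) ^ k)))"
    \<comment> \<open>The explicit rate already holds on the whole interval below
      \<open>gbar\<close>, so any positive number below \<open>gbar\<close> would serve.\<close>
    proof (rule exI[of _ "gbar / 2"], intro conjI allI impI, goal_cases)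
      case (3 gam)
      then have "0 < gam" "gam < gbar" using gbar by auto
      then show ?case using 3(2) by (rule rate)
    qed (use gbar in auto)
  qed
qed

end
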